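(* Let $(R,\mathfrak m,k)$ be a stretched artinian local ring, not a field, with invariants $v,r,h,p,q$, elements $t,z_i,w_j,a_{ij}$ and Koszul complex $K^R=R\langle W_1,\dots,W_q,Z_1,\dots,Z_p,T\rangle$ as described in the context; assume $h\ge 3$ and $r\ne v$. Consider the cycle in $K^R_1$ $$F=\sum_{1\le i<j\le q}\alpha_{ij}w_iW_j+\sum_{1\le j\le q,\,1\le i\le p}\beta_{ij}w_jZ_i+\sum_{1\le i\le q}\gamma_iw_iT+\sum_{1\le i\le p}\delta_itZ_i+\sum_{(i,j)\in\mathcal J_1}\eta_{ij}\bigl(t^{h-1}T-a_{ij}^{-1}z_iZ_j\bigr)+\sum_{(i,j)\in\mathcal J_2}\theta_{ij}z_iZ_j$$ where $\alpha_{ij},\beta_{ij},\gamma_i,\delta_i,\eta_{ij},\theta_{ij}\in R$, and $\mathcal J_1=\{(i,j)\mid 1\le i\le j\le p,\ a_{ij}\ne 0\}$, $\mathcal J_2=\{(i,j)\mid 1\le i\le j\le p,\ a_{ij}=0\}$. Assume that at least one of the coefficients $\delta_i$, $\eta_{ij}$, or $\theta_{ij}$ is a unit. If $z$ is a cycle in $\mathfrak m^2K^R$, then $z=AF+A'$ for some $A\in Z(\mathfrak mK^R)$ and $A'\in B(\mathfrak mK^R)$. In other words, condition $\mathcal P_{2,1}$ holds for $R$ with $l=F$.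
   Context: For an artinian local ring $(R,\mathfrak m,k)$ put $v=\operatorname{rank}_k(\mathfrak m/\mathfrak m^2)$, $e=\operatorname{length}(R)$, $r=\operatorname{rank}_k(0:\mathfrak m)$, $h=e-v$; $R$ is stretched if $h$ is the least integer $i$ with $\mathfrak m^{i+1}=0$. Put $p=v-r$ and $q=r-1$. When $R$ is stretched, not a field, and $h\ge 3$, one can choose (Sally) a minimal generating system $t,z_1,\dots,z_p,w_1,\dots,w_q$ of $\mathfrak m$ such that: (1) $\mathfrak m^i=(t^i)$ for all $i\ge 2$; (2) $w_1,\dots,w_{r-1},t^h$ form a basis of $(0:\mathfrak m)$ (so $tw_j=0$ and $z_iw_j=0$ for all $i,j$); (3) $tz_i=0$ for $1\le i\le p$; (4) $z_iz_j=a_{ij}t^h$ for $1\le i,j\le p$, with each $a_{ij}\in R$ either $0$ or a unit. Fix such a choice. $K^R=R\langle W_1,\dots,W_q,Z_1,\dots,Z_p,T\rangle$ is the Koszul complex on $w_1,\dots,w_q,z_1,\dots,z_p,t$, i.e. the exterior DG algebra on degree-one variables with $\partial(W_i)=w_i$, $\partial(Z_i)=z_i$, $\partial(T)=t$. $Z(\mathfrak m^jK^R)$ denotes the cycles of the subcomplex $\mathfrak m^jK^R$ and $B(\mathfrak m^jK^R)=\partial(\mathfrak m^jK^R)$. Condition $\mathcal P_{2,1}$ (with a cycle $l\in K^R_1$): for every $z\in Z(\mathfrak m^2K^R)$ there exists $z'\in Z(\mathfrak mK^R)$ such that $z-z'l\in B(\mathfrak mK^R)$. *)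

theory Defs
  imports Complex_Main "HOL-Library.Function_Algebras"
begin

subsection \<open>Ideals of a commutative ring (the ring is the whole type)\<close>

abbreviation ideal :: "'a::comm_ring_1 set \<Rightarrow> bool" where
  "ideal \<equiv> module.subspace (*)"

abbreviation ideal_gen :: "'a::comm_ring_1 set \<Rightarrow> 'a set" where
  "ideal_gen \<equiv> module.span (*)"

definition ideal_prod :: "'a::comm_ring_1 set \<Rightarrow> 'a set \<Rightarrow> 'a set" where
  "ideal_prod I J = ideal_gen {a * b | a b. a \<in> I \<and> b \<in> J}"

primrec ideal_pow :: "'a::comm_ring_1 set \<Rightarrow> nat \<Rightarrow> 'a set" where
  "ideal_pow I 0 = UNIV"
| "ideal_pow I (Suc n) = ideal_prod I (ideal_pow I n)"

definition annihilator :: "'a::comm_ring_1 set \<Rightarrow> 'a set" where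
  "annihilator I = {x. \<forall>y\<in>I. x * y = 0}"

definition maximal_ideal :: "'a::comm_ring_1 set \<Rightarrow> bool" where
  "maximal_ideal I \<longleftrightarrow> ideal I \<and> I \<noteq> UNIV \<and> (\<forall>J. ideal J \<and> I \<subseteq> J \<longrightarrow> J = I \<or> J = UNIV)"

definition artinian_local :: "'a::comm_ring_1 set \<Rightarrow> bool" where
  "artinian_local m \<longleftrightarrow>
     maximal_ideal m \<and> (\<forall>J. maximal_ideal J \<longrightarrow> J = m) \<and>
     (\<forall>I :: nat \<Rightarrow> 'a set. (\<forall>n. ideal (I n)) \<and> (\<forall>n. I (Suc n) \<subseteq> I n)
        \<longrightarrow> (\<exists>N. \<forall>n\<ge>N. I n = I N))"

text \<open>The family \<open>b 1, \<dots>, b n\<close> in \<open>I\<close> induces a basis of the vector space \<open>I / J\<close> over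
  the residue field \<open>R / m\<close>. This makes sense when \<open>m I \<subseteq> J \<subseteq> I\<close>; scalars are represented
  by ring elements, and a scalar vanishes in \<open>R / m\<close> iff its representative lies in \<open>m\<close>.\<close>

definition residue_basis ::
    "'a::comm_ring_1 set \<Rightarrow> 'a set \<Rightarrow> 'a set \<Rightarrow> nat \<Rightarrow> (nat \<Rightarrow> 'a) \<Rightarrow> bool" where
  "residue_basis m I J n b \<longleftrightarrow>
     (\<forall>i\<in>{1..n}. b i \<in> I) \<and>
     (\<forall>x\<in>I. \<exists>c. x - (\<Sum>i=1..n. c i * b i) \<in> J) \<and>
     (\<forall>c. (\<Sum>i=1..n. c i * b i) \<in> J \<longrightarrow> (\<forall>i\<in>{1..n}. c i \<in> m))"

definition residue_rank :: "'a::comm_ring_1 set \<Rightarrow> 'a set \<Rightarrow> 'a set \<Rightarrow> nat" where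
  "residue_rank m I J = (THE n. \<exists>b. residue_basis m I J n b)"

definition embdim :: "'a::comm_ring_1 set \<Rightarrow> nat" where
  "embdim m = residue_rank m m (ideal_pow m 2)"

definition socle_rank :: "'a::comm_ring_1 set \<Rightarrow> nat" where
  "socle_rank m = residue_rank m (annihilator m) {0}"

text \<open>The supremum is taken in \<^typ>\<open>nat\<close>, so the value is only meaningful for rings of finite
  length, such as artinian rings.\<close>

definition ring_length :: "'a::comm_ring_1 itself \<Rightarrow> nat" where
  "ring_length _ = Sup {n. \<exists>I :: nat \<Rightarrow> 'a set. (\<forall>i\<le>n. ideal (I i)) \<and> (\<forall>i<n. I i \<subset> I (Suc i))}"

definition stretch_index :: "'a::comm_ring_1 set \<Rightarrow> nat" where
  "stretch_index m = ring_length TYPE('a) - embdim m"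

definition stretched :: "'a::comm_ring_1 set \<Rightarrow> bool" where
  "stretched m \<longleftrightarrow>
     ideal_pow m (stretch_index m + 1) = {0} \<and>
     (\<forall>i<stretch_index m. ideal_pow m (i + 1) \<noteq> {0})"

definition minimal_generators :: "'a::comm_ring_1 set \<Rightarrow> nat \<Rightarrow> (nat \<Rightarrow> 'a) \<Rightarrow> bool" where
  "minimal_generators I n x \<longleftrightarrow>
     ideal_gen (x ` {1..n}) = I \<and> (\<forall>N. N \<subset> {1..n} \<longrightarrow> ideal_gen (x ` N) \<noteq> I)"

text \<open>The inverse of a unit (unspecified on non-units).\<close>

definition unit_inv :: "'a::comm_ring_1 \<Rightarrow> 'a" where
  "unit_inv a = (THE b. a * b = 1)"


subsection \<open>The Koszul complex\<close>

text \<open>The exterior algebra over \<open>R\<close> on generators \<open>e\<^sub>1, \<dots>, e\<^sub>n\<close> is free on the monomials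
  \<open>e\<^sub>S = e\<^bsub>i\<^sub>1\<^esub> \<and> \<dots> \<and> e\<^bsub>i\<^sub>k\<^esub>\<close> with \<open>S = {i\<^sub>1 < \<dots> < i\<^sub>k} \<subseteq> {1..n}\<close>. An element is represented by
  its coefficient function \<open>S \<mapsto> f S\<close>. Addition, subtraction and sums are the pointwise ones;
  the exterior product is \<open>kmult\<close>, not the pointwise \<open>(*)\<close>.\<close>

type_synonym 'a kos = "nat set \<Rightarrow> 'a"

definition kos :: "nat \<Rightarrow> 'a::comm_ring_1 kos set" where
  "kos n = {f. \<forall>S. \<not> S \<subseteq> {1..n} \<longrightarrow> f S = 0}"

definition kos_deg :: "nat \<Rightarrow> nat \<Rightarrow> 'a::comm_ring_1 kos set" where
  "kos_deg n d = {f \<in> kos n. \<forall>S. card S \<noteq> d \<longrightarrow> f S = 0}"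

definition kgen :: "nat \<Rightarrow> 'a::comm_ring_1 kos" where
  "kgen i = (\<lambda>S. if S = {i} then 1 else 0)"

definition kscale :: "'a::comm_ring_1 \<Rightarrow> 'a kos \<Rightarrow> 'a kos" (infixr "*\<^sub>K" 75) where
  "c *\<^sub>K f = (\<lambda>S. c * f S)"

text \<open>For disjoint \<open>A\<close>, \<open>B\<close> we have \<open>e\<^sub>A \<and> e\<^sub>B = (-1)\<^sup>N e\<^bsub>A \<union> B\<^esub>\<close>, where \<open>N\<close> is the number of
  inversions counted below.\<close>

definition kmult :: "'a::comm_ring_1 kos \<Rightarrow> 'a kos \<Rightarrow> 'a kos" (infixl "\<cdot>\<^sub>K" 74) where
  "f \<cdot>\<^sub>K g = (\<lambda>S. \<Sum>A\<in>Pow S.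
     (-1) ^ card {(i, j). i \<in> A \<and> j \<in> S - A \<and> j < i} * f A * g (S - A))"

text \<open>The derivation with \<open>\<partial> e\<^sub>i = x\<^sub>i\<close>:
  \<open>\<partial> e\<^sub>S = (\<Sum>i\<in>S. (-1)\<^sup>N x\<^sub>i e\<^bsub>S - {i}\<^esub>)\<close> with \<open>N\<close> the number of \<open>j \<in> S\<close>, \<open>j < i\<close>,
  written out on coefficients.\<close>

definition kdiff :: "nat \<Rightarrow> (nat \<Rightarrow> 'a::comm_ring_1) \<Rightarrow> 'a kos \<Rightarrow> 'a kos" where
  "kdiff n x f = (\<lambda>S. \<Sum>i\<in>{1..n} - S. (-1) ^ card {j \<in> S. j < i} * x i * f (insert i S))"

text \<open>The submodule \<open>I K\<close>.\<close>

definition kos_ideal :: "nat \<Rightarrow> 'a::comm_ring_1 set \<Rightarrow> 'a kos set" where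
  "kos_ideal n I = module.span (*\<^sub>K) {c *\<^sub>K f | c f. c \<in> I \<and> f \<in> kos n}"

definition cycles :: "nat \<Rightarrow> (nat \<Rightarrow> 'a::comm_ring_1) \<Rightarrow> 'a kos set \<Rightarrow> 'a kos set" where
  "cycles n x C = {f \<in> C. kdiff n x f = 0}"

definition boundaries :: "nat \<Rightarrow> (nat \<Rightarrow> 'a::comm_ring_1) \<Rightarrow> 'a kos set \<Rightarrow> 'a kos set" where
  "boundaries n x C = kdiff n x ` C"

definition cond_P21 ::
    "'a::comm_ring_1 set \<Rightarrow> nat \<Rightarrow> (nat \<Rightarrow> 'a) \<Rightarrow> 'a kos \<Rightarrow> bool" where
  "cond_P21 m n x l \<longleftrightarrow>
     l \<in> cycles n x (kos_deg n 1) \<and>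
     (\<forall>u \<in> cycles n x (kos_ideal n (ideal_pow m 2)).
        \<exists>u' \<in> cycles n x (kos_ideal n m). u - u' \<cdot>\<^sub>K l \<in> boundaries n x (kos_ideal n m))"


subsection \<open>Structure of stretched rings\<close>

text \<open>The sequence \<open>w 1, \<dots>, w q, z 1, \<dots>, z p, t\<close>, indexed by \<open>{1..q + p + 1}\<close>. In the Koszul
  complex on it, \<open>W i = kgen i\<close>, \<open>Z i = kgen (q + i)\<close> and \<open>T = kgen (q + p + 1)\<close>.\<close>

definition kos_seq ::
    "nat \<Rightarrow> nat \<Rightarrow> (nat \<Rightarrow> 'a) \<Rightarrow> (nat \<Rightarrow> 'a) \<Rightarrow> 'a \<Rightarrow> nat \<Rightarrow> 'a" where
  "kos_seq q p w z t k = (if k \<le> q then w k else if k \<le> q + p then z (k - q) else t)"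

definition sally_system ::
    "'a::comm_ring_1 set \<Rightarrow> nat \<Rightarrow> nat \<Rightarrow> (nat \<Rightarrow> 'a) \<Rightarrow> (nat \<Rightarrow> 'a) \<Rightarrow> 'a
      \<Rightarrow> (nat \<Rightarrow> nat \<Rightarrow> 'a) \<Rightarrow> bool" where
  "sally_system m q p w z t a \<longleftrightarrow>
     minimal_generators m (q + p + 1) (kos_seq q p w z t) \<and>
     (\<forall>i\<ge>2. ideal_pow m i = ideal_gen {t ^ i}) \<and>
     residue_basis m (annihilator m) {0} (q + 1)
       (\<lambda>j. if j \<le> q then w j else t ^ stretch_index m) \<and>
     (\<forall>i\<in>{1..p}. t * z i = 0) \<and>
     (\<forall>i\<in>{1..p}. \<forall>j\<in>{1..p}. z i * z j = a i j * t ^ stretch_index m \<and> (a i j = 0 \<or> a i j dvd 1))"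


subsection \<open>Basic facts\<close>

lemma module_ring: "module ((*) :: 'a::comm_ring_1 \<Rightarrow> 'a \<Rightarrow> 'a)"
  by unfold_locales (simp_all add: algebra_simps)

lemma module_kscale: "module ((*\<^sub>K) :: 'a::comm_ring_1 \<Rightarrow> 'a kos \<Rightarrow> 'a kos)"
  by unfold_locales (simp_all add: kscale_def fun_eq_iff algebra_simps)

lemma kos_sum_apply: "(\<Sum>i\<in>X. f i :: 'a::comm_ring_1 kos) S = (\<Sum>i\<in>X. f i S)"
  by (induction X rule: infinite_finite_induct) simp_all

lemma kdiff_kgen:
  assumes "i \<in> {1..n}"
  shows "kdiff n x (kgen i) = (\<lambda>S. if S = {} then x i else 0)"
proof
  fix S :: "nat set"
  show "kdiff n x (kgen i) S = (if S = {} then x i else 0)"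
  proof (cases "S = {}")
    case True
    have "kdiff n x (kgen i) {} = (\<Sum>k=1..n. if k = i then x i else 0)"
      unfolding kdiff_def kgen_def by (intro sum.cong) auto
    then show ?thesis using True assms by simp
  next
    case False
    then have "insert k S \<noteq> {i}" if "k \<notin> S" for k
      using that by auto
    then have "kdiff n x (kgen i) S = 0"
      unfolding kdiff_def kgen_def by (intro sum.neutral) auto
    then show ?thesis using False by simp
  qed
qed

lemma kos_ideal_iff:
  assumes "ideal I"
  shows "f \<in> kos_ideal n I \<longleftrightarrow> f \<in> kos n \<and> (\<forall>S. f S \<in> I)"
proof -
  interpret R: module "(*) :: 'a \<Rightarrow> 'a \<Rightarrow> 'a" by (rule module_ring)
  interpret K: module "(*\<^sub>K) :: 'a \<Rightarrow> 'a kos \<Rightarrow> 'a kos" by (rule module_kscale)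
  let ?G = "{c *\<^sub>K f | c f. c \<in> I \<and> f \<in> kos n} :: 'a kos set"
  let ?V = "{f. f \<in> kos n \<and> (\<forall>S. f S \<in> I)}"
  have "K.subspace ?V"
    using assms by (auto simp: K.subspace_def kos_def kscale_def
        intro: R.subspace_0 R.subspace_add R.subspace_scale)
  moreover have "?G \<subseteq> ?V"
  proof
    fix g assume "g \<in> ?G"
    then obtain c f where "g = c *\<^sub>K f" "c \<in> I" "f \<in> kos n" by auto
    then show "g \<in> ?V"
      using R.subspace_scale[OF assms \<open>c \<in> I\<close>]
      by (auto simp: kos_def kscale_def mult.commute[of c])
  qed
  ultimately have "K.span ?G \<subseteq> ?V"
    by (rule K.span_minimal[rotated])
  moreover have "f \<in> K.span ?G" if f: "f \<in> kos n" "\<forall>S. f S \<in> I"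
  proof -
    let ?e = "\<lambda>S U. if U = S then 1 else 0 :: 'a"
    have "f = (\<Sum>S\<in>Pow {1..n}. f S *\<^sub>K ?e S)"
    proof
      fix U
      have "(\<Sum>S\<in>Pow {1..n}. f S *\<^sub>K ?e S) U = (\<Sum>S\<in>Pow {1..n}. if U = S then f S else 0)"
        unfolding kos_sum_apply by (intro sum.cong) (auto simp: kscale_def)
      also have "\<dots> = f U"
        using f(1) by (auto simp: kos_def)
      finally show "f U = (\<Sum>S\<in>Pow {1..n}. f S *\<^sub>K ?e S) U" by simp
    qed
    moreover have "f S *\<^sub>K ?e S \<in> K.span ?G" if "S \<in> Pow {1..n}" for S
    proof -
      have "?e S \<in> kos n" using that by (auto simp: kos_def)
      then show ?thesis using f(2) by (intro K.span_base) blast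
    qed
    ultimately show ?thesis
      by (metis (no_types, lifting) K.span_sum)
  qed
  ultimately show ?thesis
    unfolding kos_ideal_def by auto
qed

end

theory Submission
  imports Defs
begin

text \<open>A cycle of \<open>m\<^sup>2 K\<close> is a combination of monomials \<open>t\<^sup>2 e\<^sub>S\<close> with \<open>T\<close> absent, which are the
  boundaries of \<open>\<plusminus>t T e\<^sub>S\<close>, and of monomials \<open>t\<^sup>h e\<^sub>S\<close> with \<open>T\<close> present. As no combination of the \<open>z\<^sub>i\<close>
  with a unit coefficient lies in the socle, the pairing \<open>(y, z) \<mapsto> y z \<in> (t\<^sup>h)\<close> yields elements
  \<open>y\<^sub>1, \<dots>, y\<^sub>p\<close> dual to the \<open>z\<^sub>i\<close> that annihilate \<open>t\<close> and all \<open>w\<^sub>j\<close>. If \<open>Z\<^sub>i\<close> is absent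
  from \<open>e\<^sub>S\<close>, then \<open>t\<^sup>h e\<^sub>S\<close> is the boundary of \<open>\<plusminus>y\<^sub>i Z\<^sub>i e\<^sub>S\<close>. If \<open>T\<close> and all \<open>Z\<^sub>i\<close> are present, then \<open>t\<^sup>h e\<^sub>S\<close> is,
  up to a unit, the product of \<open>F\<close> with the cycle \<open>t\<^bsup>h-1\<^esup> e\<^bsub>S - Z\<^sub>i\<^esub> \<plusminus> y\<^sub>i e\<^bsub>S - T\<^esub>\<close> when \<open>\<delta>\<^sub>i\<close> is a
  unit, and with the cycle \<open>y\<^sub>l e\<^bsub>S - Z\<^sub>j\<^esub> \<plusminus> y\<^sub>j e\<^bsub>S - Z\<^sub>l\<^esub>\<close> (only the first summand if \<open>l = j\<close>) when
  the coefficient of \<open>z\<^sub>l Z\<^sub>j\<close> in \<open>F\<close> is a unit. Signs are never computed, since they are units.\<close>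

lemmas ideal_0 = module.subspace_0[OF module_ring]
  and ideal_add = module.subspace_add[OF module_ring]
  and ideal_scale = module.subspace_scale[OF module_ring]

section \<open>Monomials in the Koszul complex\<close>

definition kmon :: "nat set \<Rightarrow> 'a::comm_ring_1 kos" where
  "kmon S = (\<lambda>U. if U = S then 1 else 0)"

lemma kscale_apply [simp]: "(c *\<^sub>K f) S = c * f S"
  by (simp add: kscale_def)

lemma kscale_kscale [simp]: "c *\<^sub>K d *\<^sub>K f = (c * d) *\<^sub>K f"
  by (simp add: fun_eq_iff mult.assoc)

lemma kscale_zero [simp]: "0 *\<^sub>K f = 0"
  by (simp add: fun_eq_iff)

lemma kscale_zero_right [simp]: "c *\<^sub>K 0 = 0"
  by (simp add: fun_eq_iff)

lemma kscale_sum: "c *\<^sub>K (\<Sum>i\<in>X. f i) = (\<Sum>i\<in>X. c *\<^sub>K f i)"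
  by (simp add: fun_eq_iff kos_sum_apply sum_distrib_left)

lemma kscale_add: "c *\<^sub>K (f + g) = c *\<^sub>K f + c *\<^sub>K g"
  by (simp add: fun_eq_iff distrib_left)

lemma kscale_diff: "c *\<^sub>K (f - g) = c *\<^sub>K f - c *\<^sub>K g"
  by (simp add: fun_eq_iff right_diff_distrib)

lemma kos_add: "f \<in> kos n \<Longrightarrow> g \<in> kos n \<Longrightarrow> f + g \<in> kos n"
  by (simp add: kos_def)

lemma kos_kscale: "f \<in> kos n \<Longrightarrow> c *\<^sub>K f \<in> kos n"
  by (simp add: kos_def)

lemma kos_expand:
  assumes "f \<in> kos n"
  shows "f = (\<Sum>S\<in>Pow {1..n}. f S *\<^sub>K kmon S)"
proof
  fix U
  have "(\<Sum>S\<in>Pow {1..n}. f S *\<^sub>K kmon S) U = (\<Sum>S\<in>Pow {1..n}. if U = S then f S else 0)"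
    unfolding kos_sum_apply by (intro sum.cong) (auto simp: kmon_def)
  also have "\<dots> = f U"
    using assms by (auto simp: kos_def)
  finally show "f U = (\<Sum>S\<in>Pow {1..n}. f S *\<^sub>K kmon S) U" by simp
qed

lemma kscale_kmon_in_kos_ideal:
  assumes "ideal I" and "b \<in> I" and "S \<subseteq> {1..n}"
  shows "b *\<^sub>K kmon S \<in> kos_ideal n I"
  using assms ideal_0[OF assms(1)]
  by (auto simp: kos_ideal_iff kos_def kmon_def)

lemma kos_ideal_add:
  assumes "ideal I" and "f \<in> kos_ideal n I" and "g \<in> kos_ideal n I"
  shows "f + g \<in> kos_ideal n I"
  using assms by (auto simp: kos_ideal_iff kos_add intro: ideal_add)

lemma kos_ideal_kscale:
  assumes "ideal I" and "f \<in> kos_ideal n I"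
  shows "c *\<^sub>K f \<in> kos_ideal n I"
  using assms by (auto simp: kos_ideal_iff kos_kscale intro: ideal_scale)

section \<open>Linearity of the differential and of the product\<close>

lemma kdiff_add: "kdiff n x (f + g) = kdiff n x f + kdiff n x g"
  by (simp add: kdiff_def fun_eq_iff distrib_left sum.distrib)

lemma kdiff_kscale: "kdiff n x (c *\<^sub>K f) = c *\<^sub>K kdiff n x f"
  by (simp add: kdiff_def fun_eq_iff sum_distrib_left ac_simps)

lemma kdiff_zero [simp]: "kdiff n x 0 = 0"
  by (simp add: kdiff_def fun_eq_iff)

lemma kdiff_diff: "kdiff n x (f - g) = kdiff n x f - kdiff n x g"
  by (simp add: kdiff_def fun_eq_iff right_diff_distrib sum_subtractf)

lemma kmult_add_left: "(f + g) \<cdot>\<^sub>K l = f \<cdot>\<^sub>K l + g \<cdot>\<^sub>K l"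
  by (simp add: kmult_def fun_eq_iff distrib_left distrib_right sum.distrib)

lemma kmult_kscale_left: "(c *\<^sub>K f) \<cdot>\<^sub>K l = c *\<^sub>K (f \<cdot>\<^sub>K l)"
  by (simp add: kmult_def fun_eq_iff sum_distrib_left ac_simps)

lemma kmult_zero_left [simp]: "0 \<cdot>\<^sub>K l = 0"
  by (simp add: kmult_def fun_eq_iff)

section \<open>Differential and product of a single monomial\<close>

lemma kdiff_kmon_eq_0:
  assumes "\<And>k. k \<in> S \<Longrightarrow> b * x k = 0"
  shows "kdiff n x (b *\<^sub>K kmon S) = 0"
proof
  fix U
  have "(-1) ^ card {j \<in> U. j < i} * x i * (b *\<^sub>K kmon S) (insert i U) = 0" for i
  proof (cases "insert i U = S")
    case True
    then have "x i * b = 0" using assms[of i] by (auto simp: mult.commute)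
    then show ?thesis using True by (simp add: kmon_def mult.assoc)
  qed (simp add: kmon_def)
  then show "kdiff n x (b *\<^sub>K kmon S) U = 0 U"
    unfolding kdiff_def by (intro trans[OF sum.neutral]) auto
qed

text \<open>Only the term of the boundary that removes \<open>i\<close> survives, since
  \<open>b\<close> kills the other \<open>x k\<close>. The sign stays an unspecified \<epsilon>, to
  be cancelled later as a unit.\<close>

lemma kdiff_kmon_insert:
  fixes x :: "nat \<Rightarrow> 'a::comm_ring_1"
  assumes "i \<in> {1..n}" and "i \<notin> S" and "\<And>k. k \<in> S \<Longrightarrow> b * x k = 0"
  obtains \<epsilon> :: 'a where "\<epsilon> = 1 \<or> \<epsilon> = -1"
    and "kdiff n x (b *\<^sub>K kmon (insert i S)) = (\<epsilon> * (b * x i)) *\<^sub>K kmon S"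
proof
  let ?e = "(-1) ^ card {j \<in> S. j < i} :: 'a"
  show "?e = 1 \<or> ?e = -1"
    by (cases "even (card {j \<in> S. j < i})") auto
  show "kdiff n x (b *\<^sub>K kmon (insert i S)) = (?e * (b * x i)) *\<^sub>K kmon S"
  proof
    fix U
    have *: "(-1) ^ card {j \<in> U. j < k} * x k * (b *\<^sub>K kmon (insert i S)) (insert k U)
          = (if k = i then if U = S then ?e * (b * x i) else 0 else 0)" if "k \<in> {1..n} - U" for k
    proof (cases "insert k U = insert i S")
      case True
      show ?thesis
      proof (cases "k = i")
        case True
        with \<open>insert k U = insert i S\<close> that assms(2) have "U = S" by auto
        with True show ?thesis by (simp add: kmon_def)
      next
        case False
        then have "b * x k = 0" using True assms(3) by auto
        then have "x k * b = 0" by (simp add: mult.commute)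
        then show ?thesis using False by (simp add: kmon_def mult.assoc)
      qed
    next
      case False
      then show ?thesis by (auto simp: kmon_def)
    qed
    have "kdiff n x (b *\<^sub>K kmon (insert i S)) U
        = (\<Sum>k\<in>{1..n} - U. if k = i then if U = S then ?e * (b * x i) else 0 else 0)"
      unfolding kdiff_def by (intro sum.cong refl *)
    also have "\<dots> = ((?e * (b * x i)) *\<^sub>K kmon S) U"
      using assms(1,2) by (simp add: kmon_def)
    finally show "kdiff n x (b *\<^sub>K kmon (insert i S)) U = ((?e * (b * x i)) *\<^sub>K kmon S) U" .
  qed
qed

text \<open>Only the summand \<open>A = S\<close> can be nonzero. Finiteness of \<open>U\<close>
  enters because a sum over the infinite set \<open>Pow U\<close> is 0 by convention.\<close>

lemma kmult_kmon_eval: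
  "((b *\<^sub>K kmon S) \<cdot>\<^sub>K f) U =
     (if finite U \<and> S \<subseteq> U
      then (-1) ^ card {(i, j). i \<in> S \<and> j \<in> U - S \<and> j < i} * (b * f (U - S)) else 0)"
proof (cases "finite U")
  case True
  have "((b *\<^sub>K kmon S) \<cdot>\<^sub>K f) U = (\<Sum>A\<in>Pow U. if A = S
      then (-1) ^ card {(i, j). i \<in> S \<and> j \<in> U - S \<and> j < i} * (b * f (U - S)) else 0)"
    unfolding kmult_def by (intro sum.cong) (auto simp: kmon_def mult.assoc)
  then show ?thesis using True by simp
next
  case False
  then show ?thesis by (simp add: kmult_def)
qed

lemma kos_deg_1_eval:
  assumes "f \<in> kos_deg n 1" and "\<not> (\<exists>k\<in>{1..n}. U = {k})"
  shows "f U = 0"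
proof (cases "card U = 1")
  case True
  then obtain k where "U = {k}" by (auto simp: card_1_singleton_iff)
  with assms show ?thesis by (auto simp: kos_deg_def kos_def)
next
  case False
  with assms(1) show ?thesis by (auto simp: kos_deg_def)
qed

text \<open>A factor of degree one adds a single index, and an index already in \<open>S\<close>
  yields no monomial.\<close>

lemma kmult_kmon_eq_0:
  assumes "f \<in> kos_deg n 1" and "\<And>k. k \<in> {1..n} - S \<Longrightarrow> b * f {k} = 0"
  shows "(b *\<^sub>K kmon S) \<cdot>\<^sub>K f = 0"
proof
  fix U
  have "b * f (U - S) = 0"
  proof (cases "\<exists>k\<in>{1..n}. U - S = {k}")
    case True
    then show ?thesis using assms(2) by fastforce
  next
    case False
    then show ?thesis using kos_deg_1_eval[OF assms(1), of "U - S"] by auto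
  qed
  then show "((b *\<^sub>K kmon S) \<cdot>\<^sub>K f) U = 0 U"
    by (simp add: kmult_kmon_eval)
qed

lemma kmult_kmon_insert:
  fixes f :: "'a::comm_ring_1 kos"
  assumes f: "f \<in> kos_deg n 1" and "S \<subseteq> {1..n}" and "i \<in> {1..n}" and "i \<notin> S"
    and zero: "\<And>k. k \<in> {1..n} - insert i S \<Longrightarrow> b * f {k} = 0"
  obtains \<epsilon> :: 'a where "\<epsilon> = 1 \<or> \<epsilon> = -1"
    and "(b *\<^sub>K kmon S) \<cdot>\<^sub>K f = (\<epsilon> * (b * f {i})) *\<^sub>K kmon (insert i S)"
proof
  let ?N = "card {(k, j). k \<in> S \<and> j \<in> insert i S - S \<and> j < k}"
  let ?e = "(-1) ^ ?N :: 'a"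
  show "?e = 1 \<or> ?e = -1"
    by (cases "even ?N") auto
  show "(b *\<^sub>K kmon S) \<cdot>\<^sub>K f = (?e * (b * f {i})) *\<^sub>K kmon (insert i S)"
  proof
    fix U
    show "((b *\<^sub>K kmon S) \<cdot>\<^sub>K f) U = ((?e * (b * f {i})) *\<^sub>K kmon (insert i S)) U"
    proof (cases "U = insert i S")
      case True
      moreover have "finite (insert i S)" using assms(2) finite_subset by auto
      moreover have "insert i S - S = {i}" using assms(4) by auto
      ultimately show ?thesis
        unfolding True kmult_kmon_eval by (simp add: kmon_def subset_insertI mult.assoc)
    next
      case False
      have "b * f (U - S) = 0" if "S \<subseteq> U"
      proof (cases "\<exists>k\<in>{1..n}. U - S = {k}")
        case True
        then obtain k where "k \<in> {1..n}" "U - S = {k}" by auto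
        moreover have "k \<noteq> i" using \<open>U - S = {k}\<close> that False by auto
        ultimately show ?thesis using zero[of k] by auto
      next
        case False
        then show ?thesis using kos_deg_1_eval[OF f, of "U - S"] by auto
      qed
      then show ?thesis using False by (simp add: kmult_kmon_eval) (simp add: kmon_def)
    qed
  qed
qed

section \<open>Cycles as multiples of a cycle of degree one\<close>

text \<open>The elements \<open>y i\<close> are dual to the generators \<open>x i\<close>, \<open>i \<in> D\<close>, with respect to the pairing
  with values in the socle line spanned by \<open>s\<close>. In the application \<open>x n = t\<close>, \<open>s = t\<^sup>h\<close>,
  \<open>\<tau> = t\<^bsup>h-1\<^esup>\<close>, and \<open>D\<close> is the set of positions of the \<open>Z\<close>-variables.\<close>

locale dual_koszul =
  fixes m :: "'a::comm_ring_1 set" and n :: nat and x :: "nat \<Rightarrow> 'a" and D :: "nat set"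
    and t s \<tau> :: 'a and y :: "nat \<Rightarrow> 'a" and F :: "'a kos"
    and d :: "nat \<Rightarrow> 'a" and c :: "nat \<Rightarrow> nat \<Rightarrow> 'a"
  assumes ideal_m: "ideal m"
    and n_pos: "n \<in> {1..n}" and x_n: "x n = t" and D_subset: "D \<subseteq> {1..<n}"
    and t_m: "t \<in> m" and \<tau>_m: "\<tau> \<in> m" and \<tau>_t: "\<tau> * t = s"
    and t_x: "k \<in> {1..<n} \<Longrightarrow> t * x k = 0" and \<tau>_x: "k \<in> {1..<n} \<Longrightarrow> \<tau> * x k = 0"
    and y_m: "i \<in> D \<Longrightarrow> y i \<in> m"
    and y_x: "i \<in> D \<Longrightarrow> k \<in> {1..n} \<Longrightarrow> y i * x k = (if k = i then s else 0)"
    and F_deg: "F \<in> kos_deg n 1"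
    and \<tau>_F: "k \<in> {1..n} \<Longrightarrow> \<tau> * F {k} = (if k \<in> D then d k * s else 0)"
    and y_F: "l \<in> D \<Longrightarrow> k \<in> {1..n} \<Longrightarrow> y l * F {k} = (if k \<in> D then c l k * s else 0)"
    and c_upper: "l \<in> D \<Longrightarrow> k \<in> D \<Longrightarrow> k < l \<Longrightarrow> c l k = 0"
begin

section \<open>The submodule \<open>Z(m K) F + B(m K)\<close> of elements of the required
  form\<close>

definition repr :: "'a kos set" where
  "repr = {u. \<exists>A \<in> cycles n x (kos_ideal n m). \<exists>A' \<in> boundaries n x (kos_ideal n m).
     u = A \<cdot>\<^sub>K F + A'}"

lemma n_notin_D: "n \<notin> D"
  using D_subset by auto

lemma reprI:
  assumes "A \<in> kos_ideal n m" and "kdiff n x A = 0" and "B \<in> kos_ideal n m"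
    and "u = A \<cdot>\<^sub>K F + kdiff n x B"
  shows "u \<in> repr"
  using assms by (auto simp: repr_def cycles_def boundaries_def)

lemma reprE:
  assumes "u \<in> repr"
  obtains A B where "A \<in> kos_ideal n m" "kdiff n x A = 0" "B \<in> kos_ideal n m"
    "u = A \<cdot>\<^sub>K F + kdiff n x B"
  using assms by (auto simp: repr_def cycles_def boundaries_def)

lemma zero_in_kos_ideal: "0 \<in> kos_ideal n m"
  using ideal_m ideal_0[OF ideal_m] by (simp add: kos_ideal_iff kos_def)

lemma repr_boundary: "B \<in> kos_ideal n m \<Longrightarrow> kdiff n x B \<in> repr"
  by (rule reprI[OF zero_in_kos_ideal]) auto

lemma repr_multiple: "A \<in> kos_ideal n m \<Longrightarrow> kdiff n x A = 0 \<Longrightarrow> A \<cdot>\<^sub>K F \<in> repr"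
  by (rule reprI[OF _ _ zero_in_kos_ideal]) auto

lemma repr_zero: "0 \<in> repr"
  using repr_boundary[OF zero_in_kos_ideal] by simp

lemma repr_add:
  assumes "u \<in> repr" and "v \<in> repr"
  shows "u + v \<in> repr"
proof -
  obtain A B where 1: "A \<in> kos_ideal n m" "kdiff n x A = 0" "B \<in> kos_ideal n m"
    "u = A \<cdot>\<^sub>K F + kdiff n x B" using assms(1) by (rule reprE)
  obtain A' B' where 2: "A' \<in> kos_ideal n m" "kdiff n x A' = 0" "B' \<in> kos_ideal n m"
    "v = A' \<cdot>\<^sub>K F + kdiff n x B'" using assms(2) by (rule reprE)
  show ?thesis
  proof (rule reprI)
    show "A + A' \<in> kos_ideal n m" "B + B' \<in> kos_ideal n m"
      using 1 2 ideal_m by (auto intro: kos_ideal_add)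
    show "kdiff n x (A + A') = 0" using 1 2 by (simp add: kdiff_add)
    show "u + v = (A + A') \<cdot>\<^sub>K F + kdiff n x (B + B')"
      using 1 2 by (simp add: kdiff_add kmult_add_left ac_simps)
  qed
qed

lemma repr_kscale:
  assumes "u \<in> repr"
  shows "e *\<^sub>K u \<in> repr"
proof -
  obtain A B where 1: "A \<in> kos_ideal n m" "kdiff n x A = 0" "B \<in> kos_ideal n m"
    "u = A \<cdot>\<^sub>K F + kdiff n x B" using assms(1) by (rule reprE)
  show ?thesis
  proof (rule reprI)
    show "e *\<^sub>K A \<in> kos_ideal n m" "e *\<^sub>K B \<in> kos_ideal n m"
      using 1 ideal_m by (auto intro: kos_ideal_kscale)
    show "kdiff n x (e *\<^sub>K A) = 0" using 1 by (simp add: kdiff_kscale)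
    show "e *\<^sub>K u = (e *\<^sub>K A) \<cdot>\<^sub>K F + kdiff n x (e *\<^sub>K B)"
      using 1 by (simp add: kdiff_kscale kmult_kscale_left kscale_add)
  qed
qed

lemma repr_sum: "(\<And>i. i \<in> X \<Longrightarrow> u i \<in> repr) \<Longrightarrow> (\<Sum>i\<in>X. u i) \<in> repr"
  by (induction X rule: infinite_finite_induct) (simp_all add: repr_zero repr_add)

text \<open>This removes the signs as well as the unit coefficients of \<open>F\<close>.\<close>

lemma repr_unit:
  assumes "e dvd 1" and "(e * b) *\<^sub>K u \<in> repr"
  shows "b *\<^sub>K u \<in> repr"
proof -
  obtain e' where "e' * e = 1" using assms(1) by (auto simp: dvd_def mult.commute)
  then have "e' * (e * b) = b" by (simp flip: mult.assoc)
  with repr_kscale[OF assms(2), of e'] show ?thesis by simp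
qed

section \<open>Monomials in this submodule\<close>

lemma sign_dvd_1: "\<epsilon> = 1 \<or> \<epsilon> = -1 \<Longrightarrow> (\<epsilon> :: 'a) dvd 1"
  by auto

text \<open>Up to sign this is the boundary of \<open>b *\<^sub>K kmon (insert i S)\<close>, because
  \<open>b\<close> kills \<open>x k\<close> for \<open>k \<in> S\<close>.\<close>

lemma repr_kmon_boundary:
  assumes "b \<in> m" and "i \<in> {1..n}" and "i \<notin> S" and "S \<subseteq> {1..n}"
    and "\<And>k. k \<in> S \<Longrightarrow> b * x k = 0"
  shows "(b * x i) *\<^sub>K kmon S \<in> repr"
proof -
  obtain \<epsilon> :: 'a where \<epsilon>: "\<epsilon> = 1 \<or> \<epsilon> = -1"
    and eq: "kdiff n x (b *\<^sub>K kmon (insert i S)) = (\<epsilon> * (b * x i)) *\<^sub>K kmon S"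
    using assms(2,3,5) by (rule kdiff_kmon_insert)
  have "b *\<^sub>K kmon (insert i S) \<in> kos_ideal n m"
    using assms ideal_m by (intro kscale_kmon_in_kos_ideal) auto
  from repr_boundary[OF this] show ?thesis
    unfolding eq by (rule repr_unit[OF sign_dvd_1[OF \<epsilon>]])
qed

text \<open>Two monomials whose differentials agree up to sign combine to a cycle.\<close>

lemma repr_cycle_pair:
  assumes "b \<in> m" and "b' \<in> m" and S: "S \<subseteq> {1..n}"
    and i: "i \<in> {1..n}" "i \<notin> S" and j: "j \<in> {1..n}" "j \<notin> S"
    and b: "\<And>k. k \<in> S \<Longrightarrow> b * x k = 0" and b': "\<And>k. k \<in> S \<Longrightarrow> b' * x k = 0"
    and eq: "b * x i = b' * x j"
    and zero: "(b' *\<^sub>K kmon (insert j S)) \<cdot>\<^sub>K F = 0"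
  shows "(b *\<^sub>K kmon (insert i S)) \<cdot>\<^sub>K F \<in> repr"
proof -
  obtain \<epsilon> :: 'a where \<epsilon>: "\<epsilon> = 1 \<or> \<epsilon> = -1"
    and 1: "kdiff n x (b *\<^sub>K kmon (insert i S)) = (\<epsilon> * (b * x i)) *\<^sub>K kmon S"
    using i b by (rule kdiff_kmon_insert)
  obtain \<epsilon>' :: 'a where \<epsilon>': "\<epsilon>' = 1 \<or> \<epsilon>' = -1"
    and 2: "kdiff n x (b' *\<^sub>K kmon (insert j S)) = (\<epsilon>' * (b' * x j)) *\<^sub>K kmon S"
    using j b' by (rule kdiff_kmon_insert)
  \<comment> \<open>The coefficient makes the two boundaries cancel, because
    \<open>\<epsilon>' * \<epsilon>' = 1\<close> and \<open>b * x i = b' * x j\<close>.\<close>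
  let ?A = "b *\<^sub>K kmon (insert i S) + (- \<epsilon> * \<epsilon>') *\<^sub>K b' *\<^sub>K kmon (insert j S)"
  have sq: "\<epsilon>' * \<epsilon>' = 1" using \<epsilon>' by auto
  have "kdiff n x ?A = (\<epsilon> * (b * x i)) *\<^sub>K kmon S + (- \<epsilon> * \<epsilon>') *\<^sub>K (\<epsilon>' * (b' * x j)) *\<^sub>K kmon S"
    by (simp only: kdiff_add kdiff_kscale[of n x "- \<epsilon> * \<epsilon>'"] 1 2)
  also have "(- \<epsilon> * \<epsilon>') *\<^sub>K (\<epsilon>' * (b' * x j)) *\<^sub>K kmon S = (- \<epsilon> * (\<epsilon>' * \<epsilon>') * (b' * x j)) *\<^sub>K kmon S"
    by (simp only: kscale_kscale mult.assoc)
  also have "(\<epsilon> * (b * x i)) *\<^sub>K kmon S + \<dots> = 0"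
    by (simp only: sq eq) (simp add: fun_eq_iff)
  finally have "kdiff n x ?A = 0" .
  moreover have "?A \<in> kos_ideal n m"
    using assms ideal_m
    by (intro kos_ideal_add kos_ideal_kscale kscale_kmon_in_kos_ideal) auto
  ultimately have "?A \<cdot>\<^sub>K F \<in> repr" by (intro repr_multiple)
  also have "?A \<cdot>\<^sub>K F = (b *\<^sub>K kmon (insert i S)) \<cdot>\<^sub>K F"
    by (simp only: kmult_add_left kmult_kscale_left[of "- \<epsilon> * \<epsilon>'"] zero) simp
  finally show ?thesis .
qed

text \<open>The element \<open>e * t\<close> lies in \<open>m\<close> and kills \<open>x k\<close>
  for \<open>k \<in> S\<close>; the remaining factor \<open>t\<close> is \<open>x n\<close>, the
  boundary of \<open>T\<close>.\<close>

lemma repr_no_T: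
  assumes "S \<subseteq> {1..n}" and "n \<notin> S"
  shows "(e * t * t) *\<^sub>K kmon S \<in> repr"
proof -
  have "e * t * x k = 0" if "k \<in> S" for k
  proof -
    have "k \<noteq> n" and "k \<in> {1..n}" using that assms by auto
    then have "t * x k = 0" by (intro t_x) simp
    then show ?thesis by (simp add: mult.assoc)
  qed
  moreover have "e * t \<in> m" using t_m by (intro ideal_scale[OF ideal_m])
  ultimately have "(e * t * x n) *\<^sub>K kmon S \<in> repr"
    using assms n_pos by (intro repr_kmon_boundary)
  then show ?thesis by (simp add: x_n)
qed

text \<open>The dual element \<open>y i\<close> kills \<open>x k\<close> for all
  \<open>k \<in> S\<close>, as \<open>i \<notin> S\<close>, while
  \<open>y i * x i = s\<close>.\<close>

lemma repr_missing_Z: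
  assumes "S \<subseteq> {1..n}" and "i \<in> D" and "i \<notin> S"
  shows "s *\<^sub>K kmon S \<in> repr"
proof -
  have i: "i \<in> {1..n}" using assms(2) D_subset by auto
  then have "y i * x i = s" using y_x[OF assms(2)] by simp
  moreover have "(y i * x i) *\<^sub>K kmon S \<in> repr"
    using assms i y_m y_x[OF assms(2)] by (intro repr_kmon_boundary) auto
  ultimately show ?thesis by simp
qed

text \<open>The monomials on \<open>S - {i}\<close> with coefficient \<tau> and on
  \<open>S - {n}\<close> with coefficient \<open>y i\<close> have the same boundary up to sign. The
  second is annihilated by \<open>F\<close>, since \<open>S - {n}\<close> contains all of
  \<open>D\<close>. For the first only the index \<open>i\<close> of \<open>D\<close> is missing,
  which gives \<open>d i * s\<close>.\<close>

lemma repr_delta: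
  assumes S: "S \<subseteq> {1..n}" "n \<in> S" "D \<subseteq> S" and i: "i \<in> D" "d i dvd 1"
  shows "s *\<^sub>K kmon S \<in> repr"
proof -
  let ?S = "S - {i} - {n}"
  have i': "i \<in> {1..<n}" "i \<in> S" using i D_subset S by auto
  have S': "?S \<subseteq> {1..<n}" using S(1) by (auto simp: order.strict_iff_order)
  have ins: "insert n ?S = S - {i}" "insert i ?S = S - {n}" "insert i (S - {i}) = S"
    using S i' by auto
  have "(y i *\<^sub>K kmon (S - {n})) \<cdot>\<^sub>K F = 0"
    using S i n_notin_D by (intro kmult_kmon_eq_0[OF F_deg]) (auto simp: y_F)
  moreover have "\<tau> * x n = y i * x i" using i' i by (simp add: x_n \<tau>_t y_x)
  ultimately have "(\<tau> *\<^sub>K kmon (insert n ?S)) \<cdot>\<^sub>K F \<in> repr"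
    using i i' S S' n_pos \<tau>_m y_m \<tau>_x y_x
    by (intro repr_cycle_pair[of \<tau> "y i" ?S n i]) (auto simp: ins)
  then have mult: "(\<tau> *\<^sub>K kmon (S - {i})) \<cdot>\<^sub>K F \<in> repr" by (simp only: ins)
  obtain \<epsilon> :: 'a where \<epsilon>: "\<epsilon> = 1 \<or> \<epsilon> = -1"
    and eq: "(\<tau> *\<^sub>K kmon (S - {i})) \<cdot>\<^sub>K F = (\<epsilon> * (\<tau> * F {i})) *\<^sub>K kmon (insert i (S - {i}))"
    using F_deg by (rule kmult_kmon_insert[where b = \<tau> and i = i and S = "S - {i}"])
      (use S i i' in \<open>auto simp: \<tau>_F\<close>)
  have "(\<epsilon> * (d i * s)) *\<^sub>K kmon S \<in> repr"
    using mult[unfolded eq ins] i \<tau>_F[of i] i' by simp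
  then show ?thesis by (rule repr_unit[OF i(2) repr_unit[OF sign_dvd_1[OF \<epsilon>]]])
qed

text \<open>For \<open>l < j\<close> only the coefficient at \<open>(l, j)\<close>, not the one at \<open>(j, l)\<close>, is present in \<open>F\<close>;
  hence the second monomial of the cycle does not interfere.\<close>

lemma repr_quadratic:
  assumes S: "S \<subseteq> {1..n}" "n \<in> S" "D \<subseteq> S" and lj: "l \<in> D" "j \<in> D" "l \<le> j" "c l j dvd 1"
  shows "s *\<^sub>K kmon S \<in> repr"
proof -
  have l': "l \<in> {1..n}" "l \<in> S" "j \<in> {1..n}" "j \<in> S" using lj D_subset S by auto
  have ins: "insert j (S - {j}) = S" using l' by auto
  have "(y l *\<^sub>K kmon (S - {j})) \<cdot>\<^sub>K F \<in> repr"
  \<comment> \<open>For \<open>l = j\<close> a single monomial is already a cycle, as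
    \<open>y l\<close> kills every \<open>x k\<close> with \<open>k \<noteq> l\<close>.\<close>
  proof (cases "l = j")
    case True
    have "kdiff n x (y l *\<^sub>K kmon (S - {j})) = 0"
      using lj S True by (intro kdiff_kmon_eq_0) (auto simp: y_x)
    then show ?thesis
      using S lj ideal_m y_m by (intro repr_multiple kscale_kmon_in_kos_ideal) auto
  next
    case False
    let ?S = "S - {l} - {j}"
    have ins': "insert l ?S = S - {j}" "insert j ?S = S - {l}"
      using l' False by auto
    have "y j * F {k} = 0" if "k \<in> {1..n} - (S - {l})" for k
      using that lj S False c_upper[of j l] by (auto simp: y_F)
    then have "(y j *\<^sub>K kmon (insert j ?S)) \<cdot>\<^sub>K F = 0"
      unfolding ins' by (intro kmult_kmon_eq_0[OF F_deg])
    moreover have "y l * x l = y j * x j" using l' lj by (simp add: y_x)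
    ultimately have "(y l *\<^sub>K kmon (insert l ?S)) \<cdot>\<^sub>K F \<in> repr"
      using l' lj S y_m y_x
      by (intro repr_cycle_pair[of "y l" "y j" ?S l j]) auto
    then show ?thesis by (simp only: ins')
  qed
  note mult = this
  obtain \<epsilon> :: 'a where \<epsilon>: "\<epsilon> = 1 \<or> \<epsilon> = -1"
    and eq: "(y l *\<^sub>K kmon (S - {j})) \<cdot>\<^sub>K F = (\<epsilon> * (y l * F {j})) *\<^sub>K kmon (insert j (S - {j}))"
    using F_deg by (rule kmult_kmon_insert[where b = "y l" and i = j and S = "S - {j}"])
      (use S lj l' in \<open>auto simp: y_F\<close>)
  have "(\<epsilon> * (c l j * s)) *\<^sub>K kmon S \<in> repr"
    using mult[unfolded eq ins] lj l' by (simp add: y_F)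
  then show ?thesis by (rule repr_unit[OF lj(4) repr_unit[OF sign_dvd_1[OF \<epsilon>]]])
qed

text \<open>Membership is checked on each monomial of \<open>u\<close>. For monomials containing
  \<open>T\<close> the cycle condition and \<open>ann_t\<close> make the coefficient a multiple of
  \<open>s\<close>, so that \<open>s *\<^sub>K kmon S\<close> is all that has to be treated.\<close>

lemma cycle_in_repr:
  assumes unit: "(\<exists>i\<in>D. d i dvd 1) \<or> (\<exists>l\<in>D. \<exists>j\<in>D. l \<le> j \<and> c l j dvd 1)"
    and ann_t: "\<And>e. e * t * t * t = 0 \<Longrightarrow> \<exists>e'. e * t * t = e' * s"
    and u: "u \<in> kos n" "kdiff n x u = 0" "\<And>S. \<exists>e. u S = e * t * t"
  shows "u \<in> repr"
proof -
  have "u S *\<^sub>K kmon S \<in> repr" if S: "S \<subseteq> {1..n}" for S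
  proof (cases "n \<in> S")
    case False
    obtain e where "u S = e * t * t" using u(3) by blast
    then show ?thesis using repr_no_T[OF S False] by simp
  next
    case True
    let ?U = "S - {n}"
    let ?sgn = "\<lambda>i. (-1) ^ card {j \<in> ?U. j < i} :: 'a"
    have "x i * u V = 0" if "i \<in> {1..<n}" for i V
    proof -
      obtain e where "u V = e * t * t" using u(3) by blast
      then have "x i * u V = e * t * (t * x i)" by (simp add: ac_simps)
      then show ?thesis using t_x[OF that] by simp
    qed
    \<comment> \<open>Since every \<open>x i\<close> with \<open>i < n\<close> kills the
      coefficients of \<open>u\<close>, the coefficient of the boundary at \<open>S - {n}\<close>
      retains only the term that inserts \<open>n\<close>.\<close>
    then have *: "?sgn i * x i * u (insert i ?U) = (if i = n then ?sgn n * (t * u S) else 0)"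
      if "i \<in> {1..n} - ?U" for i
      using that True by (cases "i = n") (auto simp: x_n mult.assoc insert_absorb)
    have "0 = kdiff n x u ?U" by (simp add: u)
    also have "\<dots> = (\<Sum>i\<in>{1..n} - ?U. if i = n then ?sgn n * (t * u S) else 0)"
      unfolding kdiff_def by (intro sum.cong refl *)
    also have "\<dots> = ?sgn n * (t * u S)" using n_pos by simp
    finally have "t * u S = 0"
      by (cases "even (card {j \<in> ?U. j < n})") auto
    moreover obtain e where "u S = e * t * t" using u(3) by blast
    ultimately have "e * t * t * t = 0" by (simp add: ac_simps)
    from ann_t[OF this] obtain e' where "u S = e' * s" using \<open>u S = e * t * t\<close> by auto
    moreover have "s *\<^sub>K kmon S \<in> repr"
    proof -
      consider i where "i \<in> D" "i \<notin> S" | i where "D \<subseteq> S" "i \<in> D" "d i dvd 1"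
        | l j where "D \<subseteq> S" "l \<in> D" "j \<in> D" "l \<le> j" "c l j dvd 1"
        using unit by blast
      then show ?thesis
      proof cases
        case 1
        with S show ?thesis by (rule repr_missing_Z)
      next
        case 2
        with S True show ?thesis by (intro repr_delta)
      next
        case 3
        with S True show ?thesis by (intro repr_quadratic)
      qed
    qed
    ultimately show ?thesis using repr_kscale[of "s *\<^sub>K kmon S" e'] by simp
  qed
  then have "(\<Sum>S\<in>Pow {1..n}. u S *\<^sub>K kmon S) \<in> repr" by (intro repr_sum) blast
  then show ?thesis unfolding kos_expand[OF u(1), symmetric] .
qed

end

section \<open>Local rings with nilpotent maximal ideal\<close>

lemma power_in_ideal_pow: "e \<in> I \<Longrightarrow> e ^ k \<in> ideal_pow I k"
proof (induction k)
  case (Suc k)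
  then have "e * e ^ k \<in> {a * b | a b. a \<in> I \<and> b \<in> ideal_pow I k}" by blast
  then show ?case
    unfolding ideal_pow.simps ideal_prod_def power_Suc by (rule module.span_base[OF module_ring])
qed simp

lemma mult_in_ideal_pow:
  "e \<in> I \<Longrightarrow> b \<in> ideal_pow I k \<Longrightarrow> e * b \<in> ideal_pow I (Suc k)"
  unfolding ideal_pow.simps ideal_prod_def by (rule module.span_base[OF module_ring]) blast

lemma ideal_gen_singleton: "ideal_gen {b} = range (\<lambda>e. e * b)"
  by (rule module.span_singleton[OF module_ring])

lemma ideal_gen_induct:
  assumes "y \<in> ideal_gen B" and "ideal J" and "B \<subseteq> J"
  shows "y \<in> J"
  using module.span_minimal[OF module_ring assms(3,2)] assms(1) by blast

text \<open>Maximality gives \<open>1 = a + b * e\<close> with \<open>a \<in> m\<close>. As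
  \<open>a\<close> is nilpotent, the geometric sum inverts \<open>1 - a\<close>, which is a multiple
  of \<open>e\<close>.\<close>

lemma dvd_1_if_notin_maximal_ideal:
  fixes m :: "'a::comm_ring_1 set"
  assumes m: "maximal_ideal m" and nil: "ideal_pow m N = {0}" and e: "e \<notin> m"
  shows "e dvd 1"
proof -
  have ideal: "ideal m" using m by (simp add: maximal_ideal_def)
  define J where "J = {a + b * e | a b. a \<in> m}"
  have JI: "a + b * e \<in> J" if "a \<in> m" for a b
    using that by (auto simp: J_def)
  have "ideal J"
  proof (rule module.subspaceI[OF module_ring])
    show "0 \<in> J" using JI[OF ideal_0[OF ideal], of 0] by simp
  next
    fix u v assume "u \<in> J" "v \<in> J"
    then obtain a b a' b' where "u = a + b * e" "v = a' + b' * e" "a \<in> m" "a' \<in> m"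
      by (auto simp: J_def)
    then show "u + v \<in> J"
      using JI[OF ideal_add[OF ideal, of a a'], of "b + b'"] by (simp add: algebra_simps)
  next
    fix k u assume "u \<in> J"
    then obtain a b where "u = a + b * e" "a \<in> m" by (auto simp: J_def)
    then show "k * u \<in> J"
      using JI[OF ideal_scale[OF ideal, of a k], of "k * b"] by (simp add: algebra_simps)
  qed
  moreover have "m \<subseteq> J" using JI[of _ 0] by auto
  moreover have "e \<in> J" using JI[OF ideal_0[OF ideal], of 1] by simp
  ultimately have "J = UNIV" using m e by (auto simp: maximal_ideal_def)
  then have "1 \<in> J" by simp
  then obtain a b where ab: "1 = a + b * e" "a \<in> m" unfolding J_def by blast
  then have "a ^ N = 0" using power_in_ideal_pow[of a m N] nil by simp
  then have "1 = (1 - a) * (\<Sum>i<N. a ^ i)" using one_diff_power_eq[of a N] by simp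
  then have "1 - a dvd 1" by (rule dvdI)
  moreover have "1 - a = e * b" using ab(1) by (simp add: eq_diff_eq diff_eq_eq mult.commute add.commute)
  then have "e dvd 1 - a" by (rule dvdI)
  ultimately show ?thesis by (rule dvd_trans[rotated])
qed

text \<open>Inverses are unique, so the definite description in \<open>unit_inv\<close> denotes
  one.\<close>

lemma mult_unit_inv:
  assumes "e dvd 1"
  shows "e * unit_inv e = 1"
proof -
  obtain b where b: "e * b = 1" using assms by (auto simp: dvd_def)
  have "b' = b" if "e * b' = 1" for b'
    using b that by (metis mult.commute mult.left_commute mult.right_neutral)
  with b show ?thesis unfolding unit_inv_def by (rule theI)
qed

text \<open>The independent functionals are the multiplications by \<open>z k\<close> on \<open>M\<close>, with values in the line
  spanned by \<open>s\<close>.\<close>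

lemma dual_family:
  fixes s :: "'a::comm_ring_1" and z :: "nat \<Rightarrow> 'a"
  assumes "finite K" and M: "ideal M"
    and val: "\<And>y k. y \<in> M \<Longrightarrow> k \<in> K \<Longrightarrow> \<exists>e. y * z k = e * s"
    and unit: "\<And>e. e * s \<noteq> 0 \<Longrightarrow> e dvd 1"
    and indep: "\<And>e k. \<forall>y\<in>M. y * (\<Sum>k\<in>K. e k * z k) = 0 \<Longrightarrow> k \<in> K \<Longrightarrow> \<not> e k dvd 1"
  shows "\<exists>y. \<forall>i\<in>K. y i \<in> M \<and> (\<forall>k\<in>K. y i * z k = (if k = i then s else 0))"
  using \<open>finite K\<close> val indep
proof (induction K)
  case (insert k0 K)
  \<comment> \<open>Independence passes to \<open>K\<close> by extending the coefficients by 0 at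
    \<open>k0\<close>.\<close>
  have "\<not> e k dvd 1" if "\<forall>y\<in>M. y * (\<Sum>k\<in>K. e k * z k) = 0" "k \<in> K" for e k
  proof -
    have "(\<Sum>k\<in>insert k0 K. (e(k0 := 0)) k * z k) = (\<Sum>k\<in>K. e k * z k)"
      using insert.hyps by (auto intro!: sum.cong)
    then have "\<not> (e(k0 := 0)) k dvd 1"
      using that insert.prems(2)[of "e(k0 := 0)" k] by simp
    then show ?thesis using that insert.hyps by (auto split: if_splits)
  qed
  note indep_K = this
  have "\<exists>y. \<forall>i\<in>K. y i \<in> M \<and> (\<forall>k\<in>K. y i * z k = (if k = i then s else 0))"
  proof (rule insert.IH)
    show "\<exists>e. y * z k = e * s" if "y \<in> M" "k \<in> K" for y k
      using insert.prems(1) that by simp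
  qed (rule indep_K)
  then obtain y' where y'_M: "\<And>i. i \<in> K \<Longrightarrow> y' i \<in> M"
    and y': "\<And>i k. i \<in> K \<Longrightarrow> k \<in> K \<Longrightarrow> y' i * z k = (if k = i then s else 0)"
    by blast
  have "\<forall>k\<in>K. \<exists>e. y' k * z k0 = e * s" using insert.prems(1) y'_M by blast
  then obtain g where g: "\<And>k. k \<in> K \<Longrightarrow> y' k * z k0 = g k * s" by metis
  have sum_g: "(\<Sum>k\<in>insert k0 K. (if k = k0 then 1 else - g k) * z k) = z k0 - (\<Sum>k\<in>K. g k * z k)"
  proof -
    have "(\<Sum>k\<in>K. (if k = k0 then 1 else - g k) * z k) = (\<Sum>k\<in>K. - (g k * z k))"
      using insert.hyps by (intro sum.cong) auto
    then show ?thesis using insert.hyps by (simp add: sum_negf)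
  qed
  \<comment> \<open>The combination has coefficient 1 at \<open>k0\<close>, so by independence some
    \<open>v \<in> M\<close> does not annihilate it.\<close>
  obtain v where v: "v \<in> M" "v * (z k0 - (\<Sum>k\<in>K. g k * z k)) \<noteq> 0"
    using insert.prems(2)[of "\<lambda>k. if k = k0 then 1 else - g k" k0] unfolding sum_g by auto
  have "\<forall>k\<in>K. \<exists>e. v * z k = e * s" using insert.prems(1) v(1) by blast
  then obtain f where f: "\<And>k. k \<in> K \<Longrightarrow> v * z k = f k * s" by metis
  \<comment> \<open>As in Gram-Schmidt, the correction makes \<open>Y\<close> orthogonal to all
    \<open>z k\<close> with \<open>k \<in> K\<close>. Its product with \<open>z k0\<close> is the
    product of \<open>v\<close> with the combination above, hence nonzero.\<close>
  define Y where "Y = v - (\<Sum>k\<in>K. f k * y' k)"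
  have "(\<Sum>k\<in>K. f k * y' k) \<in> M"
    using M y'_M by (intro module.subspace_sum[OF module_ring] ideal_scale)
  then have Y_M: "Y \<in> M"
    unfolding Y_def using M v(1) by (intro module.subspace_diff[OF module_ring])
  have Y_K: "Y * z j = 0" if "j \<in> K" for j
  proof -
    have "(\<Sum>k\<in>K. f k * y' k) * z j = (\<Sum>k\<in>K. if k = j then f k * s else 0)"
      unfolding sum_distrib_right using that y' by (intro sum.cong) (auto simp: mult.assoc)
    also have "\<dots> = v * z j" using that insert.hyps f by simp
    finally show ?thesis by (simp add: Y_def left_diff_distrib)
  qed
  have "(\<Sum>k\<in>K. f k * y' k) * z k0 = (\<Sum>k\<in>K. g k * (v * z k))"
    unfolding sum_distrib_right using g f by (intro sum.cong) (auto simp: ac_simps)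
  then have "Y * z k0 = v * (z k0 - (\<Sum>k\<in>K. g k * z k))"
    by (simp add: Y_def left_diff_distrib right_diff_distrib sum_distrib_left ac_simps)
  then have "Y * z k0 \<noteq> 0" using v(2) by simp
  moreover obtain e where e: "Y * z k0 = e * s" using insert.prems(1) Y_M by blast
  ultimately obtain e' where e': "1 = e * e'" using unit[of e] unfolding dvd_def by auto
  \<comment> \<open>Scaling by \<open>e'\<close> makes \<open>Y\<close> dual to \<open>z k0\<close>.
    Subtracting \<open>g i\<close> times this dual from \<open>y' i\<close> cancels
    \<open>y' i * z k0 = g i * s\<close>.\<close>
  define y where "y = (\<lambda>i. if i = k0 then e' * Y else y' i - g i * (e' * Y))"
  have "e' * Y * z k0 = e' * e * s" by (simp add: e mult.assoc)
  also have "\<dots> = s" using e' by (simp add: mult.commute)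
  finally have Y_k0: "e' * Y * z k0 = s" .
  have eY_M: "e' * Y \<in> M" using M Y_M by (intro ideal_scale)
  have "y i \<in> M" if "i \<in> insert k0 K" for i
    using that M y'_M eY_M
    by (auto simp: y_def intro!: module.subspace_diff[OF module_ring] ideal_scale)
  moreover have "y i * z k = (if k = i then s else 0)" if "i \<in> insert k0 K" "k \<in> insert k0 K" for i k
    using that insert.hyps Y_k0 Y_K y' g
    by (auto simp: y_def left_diff_distrib mult.assoc)
  ultimately show ?case by blast
qed simp

section \<open>Sally's generating system\<close>

locale sally =
  fixes m :: "'a::comm_ring_1 set" and q p :: nat and w z :: "nat \<Rightarrow> 'a" and t :: 'a
    and a :: "nat \<Rightarrow> nat \<Rightarrow> 'a" and h :: nat
  assumes maximal: "maximal_ideal m" and h_eq: "h = stretch_index m" and h_ge: "h \<ge> 3"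
    and stretched: "stretched m" and system: "sally_system m q p w z t a"
begin

abbreviation x :: "nat \<Rightarrow> 'a" where "x \<equiv> kos_seq q p w z t"

lemma ideal_m: "ideal m"
  using maximal by (simp add: maximal_ideal_def)

section \<open>Generators, socle and powers of \<open>t\<close>\<close>

lemma x_W: "k \<in> {1..q} \<Longrightarrow> x k = w k"
  by (simp add: kos_seq_def)

lemma x_Z: "i \<in> {1..p} \<Longrightarrow> x (q + i) = z i"
  by (simp add: kos_seq_def)

lemma x_T: "x (q + p + 1) = t"
  by (simp add: kos_seq_def)

lemma index_cases:
  assumes "k \<in> {1..q + p + 1}"
  obtains (W) "k \<in> {1..q}" | (Z) i where "i \<in> {1..p}" "k = q + i" | (T) "k = q + p + 1"
proof -
  consider "k \<le> q" | "q < k" "k \<le> q + p" | "k = q + p + 1" using assms by fastforce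
  then show ?thesis
  proof cases
    case 2
    then have "k - q \<in> {1..p}" "k = q + (k - q)" by auto
    then show ?thesis by (rule Z)
  qed (use assms W T in auto)
qed

lemma gen_x: "ideal_gen (x ` {1..q + p + 1}) = m"
  and minimal: "N \<subset> {1..q + p + 1} \<Longrightarrow> ideal_gen (x ` N) \<noteq> m"
  using system by (auto simp: sally_system_def minimal_generators_def)

lemma x_m: "k \<in> {1..q + p + 1} \<Longrightarrow> x k \<in> m"
  using module.span_base[OF module_ring] gen_x by blast

lemma t_m: "t \<in> m"
  using x_m[of "q + p + 1"] unfolding x_T by simp

lemma z_m: "i \<in> {1..p} \<Longrightarrow> z i \<in> m"
  using x_m[of "q + i"] by (simp add: x_Z)

lemma w_m: "i \<in> {1..q} \<Longrightarrow> w i \<in> m"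
  using x_m[of i] by (simp add: x_W)

lemma basis: "residue_basis m (annihilator m) {0} (q + 1) (\<lambda>j. if j \<le> q then w j else t ^ h)"
  using system unfolding sally_system_def h_eq by blast

text \<open>Both are entries of the socle basis; \<open>t ^ h\<close> has index
  \<open>q + 1\<close>.\<close>

lemma socle_w: "j \<in> {1..q} \<Longrightarrow> y \<in> m \<Longrightarrow> w j * y = 0"
  and socle_t: "y \<in> m \<Longrightarrow> t ^ h * y = 0"
proof -
  have *: "(if j \<le> q then w j else t ^ h) \<in> annihilator m" if "j \<in> {1..q + 1}" for j
    using basis that unfolding residue_basis_def by blast
  show "w j * y = 0" if "j \<in> {1..q}" "y \<in> m" for j y
    using *[of j] that by (simp add: annihilator_def)
  show "t ^ h * y = 0" if "y \<in> m" for y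
    using *[of "q + 1"] that by (simp add: annihilator_def)
qed

lemma t_z: "i \<in> {1..p} \<Longrightarrow> t * z i = 0"
  and z_z: "i \<in> {1..p} \<Longrightarrow> j \<in> {1..p} \<Longrightarrow> z i * z j = a i j * t ^ h"
  and a_cases: "i \<in> {1..p} \<Longrightarrow> j \<in> {1..p} \<Longrightarrow> a i j \<noteq> 0 \<Longrightarrow> a i j dvd 1"
  using system unfolding sally_system_def h_eq by blast+

lemma pow_m: "i \<ge> 2 \<Longrightarrow> ideal_pow m i = range (\<lambda>e. e * t ^ i)"
  using system by (simp add: sally_system_def ideal_gen_singleton)

lemma nil: "ideal_pow m (h + 1) = {0}"
  using stretched by (simp add: stretched_def h_eq)

text \<open>The ideal \<open>ideal_pow m h\<close> is generated by \<open>t ^ h\<close>, and it is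
  nonzero by minimality of \<open>h\<close>, taken at the index \<open>h - 1\<close>.\<close>

lemma t_pow_ne_0: "t ^ h \<noteq> 0"
proof -
  have "ideal_pow m (h - 1 + 1) \<noteq> {0}"
    using stretched h_ge unfolding stretched_def h_eq by (meson diff_less less_le_trans zero_less_numeral zero_less_one)
  then have "range (\<lambda>e. e * t ^ h) \<noteq> {0}" using h_ge pow_m[of h] by simp
  then show ?thesis by auto
qed

lemma t_pow_eq_0: "i > h \<Longrightarrow> t ^ i = 0"
proof -
  have "t ^ (h + 1) = 0" using nil power_in_ideal_pow[OF t_m, of "h + 1"] by simp
  then show "i > h \<Longrightarrow> t ^ i = 0"
    by (metis Suc_eq_plus1 Suc_leI le_add_diff_inverse mult_zero_left power_add)
qed

lemma unit: "e \<notin> m \<Longrightarrow> e dvd 1"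
  by (rule dvd_1_if_notin_maximal_ideal[OF maximal nil])

lemma unit_if_t_pow: "e * t ^ h \<noteq> 0 \<Longrightarrow> e dvd 1"
  using unit socle_t[of e] by (auto simp: mult.commute)

text \<open>The exponent climbs from 2 to \<open>h\<close>. If \<open>e' * t ^ j\<close> with
  \<open>j < h\<close> is killed by \<open>t\<close>, then \<open>e'\<close> is no unit, as
  \<open>t ^ h\<close> is nonzero. Hence \<open>e' \<in> m\<close>, and \<open>e' * t ^ j\<close>
  lies in \<open>ideal_pow m (j + 1)\<close>, which is generated by
  \<open>t ^ (j + 1)\<close>.\<close>

lemma annihilator_t:
  assumes "e * t ^ 3 = 0"
  shows "\<exists>e'. e * t ^ 2 = e' * t ^ h"
proof -
  have "\<exists>e'. e * t ^ 2 = e' * t ^ (2 + k)" if "2 + k \<le> h" for k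
    using that
  proof (induction k)
    case (Suc k)
    then obtain e' where e': "e * t ^ 2 = e' * t ^ (2 + k)" by auto
    have "e' * t ^ (3 + k) = 0"
      using assms arg_cong[OF e', of "\<lambda>b. b * t"] by (simp add: numeral_eq_Suc ac_simps)
    have "e' \<in> m"
    proof (rule ccontr)
      assume "e' \<notin> m"
      then obtain b where "1 = e' * b" using unit unfolding dvd_def by blast
      then have "t ^ (3 + k) = 0"
        using \<open>e' * t ^ (3 + k) = 0\<close> by (metis mult.commute mult.left_commute mult_1 mult_zero_right)
      then have "t ^ (3 + k + (h - (3 + k))) = 0" by (simp only: power_add mult_zero_left)
      then show False using t_pow_ne_0 Suc.prems by simp
    qed
    moreover have "t ^ (2 + k) \<in> ideal_pow m (2 + k)" by (rule power_in_ideal_pow[OF t_m])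
    ultimately have "e' * t ^ (2 + k) \<in> ideal_pow m (Suc (2 + k))" by (rule mult_in_ideal_pow)
    then show ?case unfolding e' by (subst (asm) pow_m) auto
  qed auto
  moreover have "2 + (h - 2) = h" using h_ge by simp
  ultimately show ?thesis by (metis order_refl)
qed

section \<open>Elements dual to the \<open>z i\<close>\<close>

lemma mult_z_in_socle:
  assumes "y \<in> m" and "k \<in> {1..p}"
  shows "\<exists>e. y * z k = e * t ^ h"
proof -
  \<comment> \<open>Since \<open>?J\<close> is an ideal, only the generators of \<open>m\<close>
    need testing: \<open>w i\<close> and \<open>t\<close> kill \<open>z k\<close>, and
    \<open>z j * z k = a j k * t ^ h\<close>.\<close>
  let ?J = "{y. \<exists>e. y * z k = e * t ^ h}"
  have "x i \<in> ?J" if "i \<in> {1..q + p + 1}" for i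
    using that
  proof (cases rule: index_cases)
    case W
    then have "x i * z k = 0 * t ^ h" using z_m assms by (simp add: x_W socle_w)
    then show ?thesis by blast
  next
    case (Z j)
    then have "x i * z k = a j k * t ^ h" using assms by (simp add: x_Z z_z)
    then show ?thesis by blast
  next
    case T
    then have "x i * z k = 0 * t ^ h" using assms unfolding T x_T by (simp add: t_z)
    then show ?thesis by blast
  qed
  then have "x ` {1..q + p + 1} \<subseteq> ?J" by (rule image_subsetI)
  moreover have "ideal ?J"
  proof (rule module.subspaceI[OF module_ring])
    show "0 \<in> ?J" by (auto intro: exI[of _ 0])
  next
    fix u v assume "u \<in> ?J" "v \<in> ?J"
    then obtain e e' where "u * z k = e * t ^ h" "v * z k = e' * t ^ h" by auto
    then have "(u + v) * z k = (e + e') * t ^ h" by (simp add: distrib_right)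
    then show "u + v \<in> ?J" by blast
  next
    fix b u assume "u \<in> ?J"
    then obtain e where "u * z k = e * t ^ h" by auto
    then have "b * u * z k = (b * e) * t ^ h" by (simp add: mult.assoc)
    then show "b * u \<in> ?J" by blast
  qed
  moreover have "y \<in> ideal_gen (x ` {1..q + p + 1})" unfolding gen_x by (rule assms(1))
  ultimately have "y \<in> ?J" by (metis ideal_gen_induct)
  then show ?thesis by simp
qed

text \<open>A socle element is a combination of the \<open>w j\<close> and \<open>t ^ h\<close>. If
  the coefficient of \<open>z k0\<close> were a unit, \<open>z k0\<close> would lie in the ideal of
  the other generators, contradicting minimality.\<close>

lemma z_independent:
  assumes "(\<Sum>k=1..p. e k * z k) \<in> annihilator m" and k0: "k0 \<in> {1..p}"
  shows "\<not> e k0 dvd 1"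
proof
  assume "e k0 dvd 1"
  then obtain b where b: "1 = e k0 * b" unfolding dvd_def by blast
  let ?I = "{1..q + p + 1}"
  let ?N = "?I - {q + k0}"
  let ?G = "ideal_gen (x ` ?N)"
  have G: "ideal ?G" by (rule module.subspace_span[OF module_ring])
  have x_G: "x k \<in> ?G" if "k \<in> ?N" for k
    using that by (intro module.span_base[OF module_ring]) blast
  have w_G: "w j \<in> ?G" if "j \<in> {1..q}" for j
    using that x_G[of j] k0 by (simp add: x_W)
  have z_G: "z i \<in> ?G" if "i \<in> {1..p} - {k0}" for i
    using that x_G[of "q + i"] by (simp add: x_Z)
  have "t \<in> ?G" using x_G[of "q + p + 1"] k0 unfolding x_T by simp
  then have th_G: "t ^ h \<in> ?G"
    using ideal_scale[OF G, of t "t ^ (h - 1)"] h_ge by (simp flip: power_Suc2)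
  obtain g where "(\<Sum>k=1..p. e k * z k) = (\<Sum>j=1..q+1. g j * (if j \<le> q then w j else t ^ h))"
    using basis assms(1) by (auto simp: residue_basis_def)
  moreover have "\<dots> \<in> ?G"
    using G w_G th_G by (intro module.subspace_sum[OF module_ring] ideal_scale) auto
  ultimately have "(\<Sum>k=1..p. e k * z k) \<in> ?G" by simp
  moreover have "(\<Sum>k\<in>{1..p} - {k0}. e k * z k) \<in> ?G"
    using G z_G by (intro module.subspace_sum[OF module_ring] ideal_scale)
  ultimately have "(\<Sum>k=1..p. e k * z k) - (\<Sum>k\<in>{1..p} - {k0}. e k * z k) \<in> ?G"
    using G by (intro module.subspace_diff[OF module_ring])
  then have "e k0 * z k0 \<in> ?G" using k0 by (simp add: sum.remove[of _ k0])
  then have "b * (e k0 * z k0) \<in> ?G" by (rule ideal_scale[OF G])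
  moreover have "b * (e k0 * z k0) = z k0"
    using b by (metis mult.assoc mult.commute mult_1)
  ultimately have "z k0 \<in> ?G" by simp
  then have "x k \<in> ?G" if "k \<in> ?I" for k
    using that x_G[of k] x_Z[OF k0] by (cases "k = q + k0") auto
  then have "x ` ?I \<subseteq> ?G" by (rule image_subsetI)
  then have "ideal_gen (x ` ?I) \<subseteq> ?G"
    using G by (intro module.span_minimal[OF module_ring])
  then have "m \<subseteq> ?G" unfolding gen_x .
  moreover have "?G \<subseteq> m"
    using x_m ideal_m by (intro module.span_minimal[OF module_ring]) auto
  ultimately have "?G = m" by (rule subset_antisym[rotated])
  moreover have "q + k0 \<in> ?I" using k0 by simp
  then have "?N \<subset> ?I" by blast
  ultimately show False using minimal by blast
qed

text \<open>\<open>dual_family\<close> is applied to the annihilator of \<open>t\<close> in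
  \<open>m\<close>. This contains all \<open>w i\<close> and \<open>z j\<close>, so a combination of
  the \<open>z k\<close> killed by it is killed by these generators, and also by \<open>t\<close>
  because \<open>t * z k = 0\<close>. It is therefore a socle element, to which
  \<open>z_independent\<close> applies.\<close>

lemma dual_z:
  obtains y where "\<And>i. i \<in> {1..p} \<Longrightarrow> y i \<in> m" and "\<And>i. i \<in> {1..p} \<Longrightarrow> y i * t = 0"
    and "\<And>i k. i \<in> {1..p} \<Longrightarrow> k \<in> {1..p} \<Longrightarrow> y i * z k = (if k = i then t ^ h else 0)"
proof -
  let ?M = "{y \<in> m. y * t = 0}"
  have "\<exists>y. \<forall>i\<in>{1..p}. y i \<in> ?M \<and> (\<forall>k\<in>{1..p}. y i * z k = (if k = i then t ^ h else 0))"
  proof (rule dual_family)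
    show "ideal ?M"
      using ideal_m
      by (intro module.subspaceI[OF module_ring])
        (auto simp: distrib_right mult.assoc intro: ideal_0 ideal_add ideal_scale)
    show "\<exists>e. y * z k = e * t ^ h" if "y \<in> ?M" "k \<in> {1..p}" for y k
      using that mult_z_in_socle by blast
    show "e dvd 1" if "e * t ^ h \<noteq> 0" for e
      using that by (rule unit_if_t_pow)
    show "\<not> e k dvd 1" if *: "\<forall>y\<in>?M. y * (\<Sum>k=1..p. e k * z k) = 0" and k: "k \<in> {1..p}" for e k
    proof (rule z_independent[OF _ k])
      let ?X = "\<Sum>k=1..p. e k * z k"
      let ?J = "{y. ?X * y = 0}"
      have "?X * x i = 0" if "i \<in> {1..q + p + 1}" for i
        using that
      proof (cases rule: index_cases)
        case W
        have "w i \<in> ?M" using w_m[OF W] socle_w[OF W t_m] by simp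
        then show ?thesis using * W by (simp add: x_W mult.commute)
      next
        case (Z j)
        have "z j \<in> ?M" using z_m[OF Z(1)] t_z[OF Z(1)] by (simp add: mult.commute)
        then show ?thesis using * Z by (simp add: x_Z mult.commute)
      next
        case T
        have "e k * z k * t = 0" if "k \<in> {1..p}" for k
          using t_z[OF that] by (simp add: mult.assoc mult.commute[of "z k"])
        then have "(\<Sum>k=1..p. e k * z k * t) = 0" by (intro sum.neutral) blast
        then show ?thesis unfolding T x_T by (simp add: sum_distrib_right)
      qed
      then have "x ` {1..q + p + 1} \<subseteq> ?J" by auto
      moreover have "ideal ?J"
        by (intro module.subspaceI[OF module_ring]) (auto simp: distrib_left mult.left_commute)
      ultimately have "ideal_gen (x ` {1..q + p + 1}) \<subseteq> ?J"
        by (intro module.span_minimal[OF module_ring])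
      then have "m \<subseteq> ?J" unfolding gen_x .
      then show "?X \<in> annihilator m" by (auto simp: annihilator_def)
    qed
  qed simp
  then show ?thesis using that by blast
qed

section \<open>The cycle \<open>F\<close>\<close>

lemma t_pow_W: "i > 0 \<Longrightarrow> j \<in> {1..q} \<Longrightarrow> t ^ i * w j = 0"
  using socle_w[of j t] t_m
  by (cases i) (auto simp: power_Suc2 mult.assoc mult.commute[of t] simp del: power_Suc)

lemma t_pow_Z: "i > 0 \<Longrightarrow> j \<in> {1..p} \<Longrightarrow> t ^ i * z j = 0"
  using t_z[of j] by (cases i) (auto simp: power_Suc2 mult.assoc simp del: power_Suc)

definition J1 :: "(nat \<times> nat) set" where
  "J1 = {(i, j). 1 \<le> i \<and> i \<le> j \<and> j \<le> p \<and> a i j \<noteq> 0}"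

definition J2 :: "(nat \<times> nat) set" where
  "J2 = {(i, j). 1 \<le> i \<and> i \<le> j \<and> j \<le> p \<and> a i j = 0}"

abbreviation W :: "nat \<Rightarrow> 'a kos" where "W i \<equiv> kgen i"
abbreviation Z :: "nat \<Rightarrow> 'a kos" where "Z i \<equiv> kgen (q + i)"
abbreviation T :: "'a kos" where "T \<equiv> kgen (q + p + 1)"

text \<open>The cycle \<open>F\<close> as a function of its coefficients, in the same form as in the
  theorem, so that the two agree by unfolding.\<close>

definition cyc ::
    "(nat \<Rightarrow> nat \<Rightarrow> 'a) \<Rightarrow> (nat \<Rightarrow> nat \<Rightarrow> 'a) \<Rightarrow> (nat \<Rightarrow> 'a) \<Rightarrow> (nat \<Rightarrow> 'a)
      \<Rightarrow> (nat \<Rightarrow> nat \<Rightarrow> 'a) \<Rightarrow> (nat \<Rightarrow> nat \<Rightarrow> 'a) \<Rightarrow> 'a kos" where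
  "cyc \<alpha> \<beta> \<gamma> \<delta> \<eta> \<theta> =
     (\<Sum>(i, j)\<in>{(i, j). 1 \<le> i \<and> i < j \<and> j \<le> q}. (\<alpha> i j * w i) *\<^sub>K W j)
     + (\<Sum>j=1..q. \<Sum>i=1..p. (\<beta> i j * w j) *\<^sub>K Z i)
     + (\<Sum>i=1..q. (\<gamma> i * w i) *\<^sub>K T)
     + (\<Sum>i=1..p. (\<delta> i * t) *\<^sub>K Z i)
     + (\<Sum>(i, j)\<in>J1. \<eta> i j *\<^sub>K (t ^ (h - 1) *\<^sub>K T - (unit_inv (a i j) * z i) *\<^sub>K Z j))
     + (\<Sum>(i, j)\<in>J2. (\<theta> i j * z i) *\<^sub>K Z j)"

lemma kgen_cycle:
  assumes "k \<in> {1..q + p + 1}" and "e * x k = 0"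
  shows "e *\<^sub>K kgen k \<in> cycles (q + p + 1) x (kos_deg (q + p + 1) 1)"
proof -
  have "kdiff (q + p + 1) x (e *\<^sub>K kgen k) = 0"
    unfolding kdiff_kscale kdiff_kgen[OF assms(1)] using assms(2) by (simp add: fun_eq_iff)
  moreover have "e *\<^sub>K kgen k \<in> kos_deg (q + p + 1) 1"
    using assms(1) by (auto simp: kos_deg_def kos_def kgen_def)
  ultimately show ?thesis by (simp add: cycles_def)
qed

text \<open>Both terms have boundary \<open>t ^ h\<close>: one as \<open>t ^ (h - 1) * t\<close>,
  the other as \<open>unit_inv (a i j) * z i * z j\<close>.\<close>

lemma J1_cycle:
  assumes "(i, j) \<in> J1"
  shows "\<eta> *\<^sub>K (t ^ (h - 1) *\<^sub>K T - (unit_inv (a i j) * z i) *\<^sub>K Z j)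
    \<in> cycles (q + p + 1) x (kos_deg (q + p + 1) 1)" (is "\<eta> *\<^sub>K ?f \<in> _")
proof -
  have ij: "i \<in> {1..p}" "j \<in> {1..p}" "a i j \<noteq> 0" using assms by (auto simp: J1_def)
  have "unit_inv (a i j) * z i * z j = (a i j * unit_inv (a i j)) * t ^ h"
    unfolding mult.assoc[of _ "z i"] z_z[OF ij(1,2)] by (simp add: ac_simps)
  then have "unit_inv (a i j) * z i * z j = t ^ h"
    using mult_unit_inv[OF a_cases[OF ij]] by simp
  moreover have "t ^ (h - 1) * t = t ^ h" using h_ge by (simp flip: power_Suc2)
  moreover have "q + j \<in> {1..q + p + 1}" "q + p + 1 \<in> {1..q + p + 1}" using ij by auto
  ultimately have "kdiff (q + p + 1) x ?f = 0"
    unfolding kdiff_diff kdiff_kscale kdiff_kgen[OF \<open>q + j \<in> _\<close>] kdiff_kgen[OF \<open>q + p + 1 \<in> _\<close>]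
      x_T x_Z[OF ij(2)]
    by (simp add: fun_eq_iff)
  then have "kdiff (q + p + 1) x (\<eta> *\<^sub>K ?f) = 0" by (simp add: kdiff_kscale)
  moreover have "\<eta> *\<^sub>K ?f \<in> kos_deg (q + p + 1) 1"
    using ij by (auto simp: kos_deg_def kos_def kgen_def)
  ultimately show ?thesis by (simp add: cycles_def)
qed

text \<open>Each summand is a cycle: the \<open>w i\<close> lie in the socle,
  \<open>t * z i = 0\<close>, \<open>J1_cycle\<close> covers the \<eta> terms, and
  \<open>z i * z j = 0\<close> on \<open>J2\<close>.\<close>

lemma cyc_cycle: "cyc \<alpha> \<beta> \<gamma> \<delta> \<eta> \<theta> \<in> cycles (q + p + 1) x (kos_deg (q + p + 1) 1)"
proof -
  define C where "C = cycles (q + p + 1) x (kos_deg (q + p + 1) 1)"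
  have add: "f + g \<in> C" if "f \<in> C" "g \<in> C" for f g
    using that by (auto simp: C_def cycles_def kos_deg_def kos_def kdiff_add)
  have "0 \<in> C" by (simp add: C_def cycles_def kos_deg_def kos_def)
  then have sum: "(\<Sum>i\<in>X. f i) \<in> C" if "\<And>i. i \<in> X \<Longrightarrow> f i \<in> C" for f and X :: "'b set"
    using that by (induction X rule: infinite_finite_induct) (simp_all add: add)
  have sum2: "(\<Sum>(i, j)\<in>X. f i j) \<in> C" if "\<And>i j. (i, j) \<in> X \<Longrightarrow> f i j \<in> C"
    for f and X :: "(nat \<times> nat) set"
    using that by (intro sum) auto
  have w_kgen: "(e * w i) *\<^sub>K kgen k \<in> C" if "i \<in> {1..q}" "k \<in> {1..q + p + 1}" for e i k
  proof -
    have "w i * x k = 0" using that by (intro socle_w x_m)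
    then show ?thesis unfolding C_def using that by (intro kgen_cycle) (simp_all add: mult.assoc)
  qed
  show ?thesis
    unfolding cyc_def C_def[symmetric]
  proof (intro add sum2 sum)
    fix i j assume "(i, j) \<in> {(i, j). 1 \<le> i \<and> i < j \<and> j \<le> q}"
    then show "(\<alpha> i j * w i) *\<^sub>K W j \<in> C" by (intro w_kgen) auto
  next
    fix i j assume "i \<in> {1..p}" "j \<in> {1..q}"
    then show "(\<beta> i j * w j) *\<^sub>K Z i \<in> C" by (intro w_kgen) auto
  next
    fix i assume "i \<in> {1..q}"
    then show "(\<gamma> i * w i) *\<^sub>K T \<in> C" by (intro w_kgen) auto
  next
    fix i assume i: "i \<in> {1..p}"
    then show "(\<delta> i * t) *\<^sub>K Z i \<in> C"
      using t_z by (unfold C_def, intro kgen_cycle) (auto simp: x_Z[OF i] mult.assoc)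
  next
    fix i j assume "(i, j) \<in> J1"
    then show "\<eta> i j *\<^sub>K (t ^ (h - 1) *\<^sub>K T - (unit_inv (a i j) * z i) *\<^sub>K Z j) \<in> C"
      unfolding C_def by (rule J1_cycle)
  next
    fix i j assume "(i, j) \<in> J2"
    then have ij: "i \<in> {1..p}" "j \<in> {1..p}" "a i j = 0" by (auto simp: J2_def)
    then have "z i * z j = 0" using z_z[of i j] by simp
    then show "(\<theta> i j * z i) *\<^sub>K Z j \<in> C"
      using ij by (unfold C_def, intro kgen_cycle) (auto simp: x_Z[OF ij(2)] mult.assoc)
  qed
qed

section \<open>Scalar multiples of \<open>F\<close>\<close>

lemma kscale_sum2: "b *\<^sub>K (\<Sum>(i, j)\<in>X. f i j) = (\<Sum>(i, j)\<in>X. b *\<^sub>K f i j)"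
  by (simp add: kscale_sum case_prod_unfold)

lemma sum_eq_0_pairs: "(\<And>i j. (i, j) \<in> X \<Longrightarrow> f i j = 0) \<Longrightarrow> (\<Sum>(i, j)\<in>X. f i j) = (0 :: 'a kos)"
  by (intro sum.neutral) auto

text \<open>The \<alpha>, \<beta> and \<gamma> terms carry a factor \<open>w j\<close>, and the
  \<open>T\<close> part of the \<eta> terms carries \<open>t ^ (h - 1)\<close>. This serves both
  \<open>b = t ^ (h - 1)\<close> and \<open>b\<close> dual to some \<open>z l\<close>.\<close>

lemma kscale_cyc:
  assumes b_w: "\<And>j. j \<in> {1..q} \<Longrightarrow> b * w j = 0" and b_t: "b * t ^ (h - 1) = 0"
  shows "b *\<^sub>K cyc \<alpha> \<beta> \<gamma> \<delta> \<eta> \<theta> =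
     (\<Sum>i=1..p. (\<delta> i * (b * t)) *\<^sub>K Z i)
     + (\<Sum>(i, j)\<in>J1. (- (\<eta> i j * unit_inv (a i j)) * (b * z i)) *\<^sub>K Z j)
     + (\<Sum>(i, j)\<in>J2. (\<theta> i j * (b * z i)) *\<^sub>K Z j)"
proof -
  have b_w': "b * (e * w j) = 0" if "j \<in> {1..q}" for e j
    using b_w[OF that] by (metis mult.left_commute mult_zero_right)
  have "b *\<^sub>K (\<Sum>(i, j)\<in>{(i, j). 1 \<le> i \<and> i < j \<and> j \<le> q}. (\<alpha> i j * w i) *\<^sub>K W j) = 0"
    unfolding kscale_sum2 by (intro sum_eq_0_pairs) (auto simp: b_w')
  moreover have "b *\<^sub>K (\<Sum>j=1..q. \<Sum>i=1..p. (\<beta> i j * w j) *\<^sub>K Z i) = 0"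
    unfolding kscale_sum by (intro sum.neutral ballI) (auto simp: b_w')
  moreover have "b *\<^sub>K (\<Sum>i=1..q. (\<gamma> i * w i) *\<^sub>K T) = 0"
    unfolding kscale_sum by (intro sum.neutral ballI) (auto simp: b_w')
  moreover have "b *\<^sub>K (\<Sum>i=1..p. (\<delta> i * t) *\<^sub>K Z i) = (\<Sum>i=1..p. (\<delta> i * (b * t)) *\<^sub>K Z i)"
    unfolding kscale_sum by (simp add: mult.left_commute)
  moreover have "b *\<^sub>K \<eta> i j *\<^sub>K (t ^ (h - 1) *\<^sub>K T - (unit_inv (a i j) * z i) *\<^sub>K Z j)
      = (- (\<eta> i j * unit_inv (a i j)) * (b * z i)) *\<^sub>K Z j" for i j
  proof -
    have "b * \<eta> i j * t ^ (h - 1) = 0"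
      using b_t by (metis mult.assoc mult.left_commute mult_zero_right)
    then show ?thesis unfolding kscale_diff kscale_kscale by (simp add: fun_eq_iff ac_simps)
  qed
  then have "b *\<^sub>K (\<Sum>(i, j)\<in>J1. \<eta> i j *\<^sub>K (t ^ (h - 1) *\<^sub>K T - (unit_inv (a i j) * z i) *\<^sub>K Z j))
      = (\<Sum>(i, j)\<in>J1. (- (\<eta> i j * unit_inv (a i j)) * (b * z i)) *\<^sub>K Z j)"
    unfolding kscale_sum2 by simp
  moreover have "b *\<^sub>K (\<Sum>(i, j)\<in>J2. (\<theta> i j * z i) *\<^sub>K Z j) = (\<Sum>(i, j)\<in>J2. (\<theta> i j * (b * z i)) *\<^sub>K Z j)"
    unfolding kscale_sum2 by (simp add: mult.left_commute)
  ultimately show ?thesis by (simp only: cyc_def kscale_add add_0_left)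
qed

lemma t_pow_cyc:
  "t ^ (h - 1) *\<^sub>K cyc \<alpha> \<beta> \<gamma> \<delta> \<eta> \<theta> = (\<Sum>i=1..p. (\<delta> i * t ^ h) *\<^sub>K Z i)"
proof -
  have pos: "h - 1 > 0" using h_ge by simp
  \<comment> \<open>Here \<open>h \<ge> 3\<close> gives \<open>2 * (h - 1) > h\<close>.\<close>
  have "t ^ (h - 1) * t ^ (h - 1) = 0"
    unfolding power_add[symmetric] using h_ge by (intro t_pow_eq_0) simp
  then have "t ^ (h - 1) *\<^sub>K cyc \<alpha> \<beta> \<gamma> \<delta> \<eta> \<theta> =
     (\<Sum>i=1..p. (\<delta> i * (t ^ (h - 1) * t)) *\<^sub>K Z i)
     + (\<Sum>(i, j)\<in>J1. (- (\<eta> i j * unit_inv (a i j)) * (t ^ (h - 1) * z i)) *\<^sub>K Z j)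
     + (\<Sum>(i, j)\<in>J2. (\<theta> i j * (t ^ (h - 1) * z i)) *\<^sub>K Z j)"
    using t_pow_W[OF pos] by (intro kscale_cyc)
  moreover have "(\<Sum>(i, j)\<in>J1. (- (\<eta> i j * unit_inv (a i j)) * (t ^ (h - 1) * z i)) *\<^sub>K Z j) = 0"
    by (intro sum_eq_0_pairs) (use h_ge in \<open>auto simp: J1_def t_pow_Z\<close>)
  moreover have "(\<Sum>(i, j)\<in>J2. (\<theta> i j * (t ^ (h - 1) * z i)) *\<^sub>K Z j) = 0"
    by (intro sum_eq_0_pairs) (use h_ge in \<open>auto simp: J2_def t_pow_Z\<close>)
  moreover have "t ^ (h - 1) * t = t ^ h" using h_ge by (simp flip: power_Suc2)
  ultimately show ?thesis by (simp only: add_0_right)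
qed

text \<open>The upper triangular matrix of the coefficients of \<open>z l\<close> times
  \<open>Z j\<close> in \<open>F\<close>; the sign and the inverse come from the \<eta>
  terms.\<close>

definition quad :: "(nat \<Rightarrow> nat \<Rightarrow> 'a) \<Rightarrow> (nat \<Rightarrow> nat \<Rightarrow> 'a) \<Rightarrow> nat \<Rightarrow> nat \<Rightarrow> 'a" where
  "quad \<eta> \<theta> l j = (if l \<le> j then if a l j = 0 then \<theta> l j else - (\<eta> l j * unit_inv (a l j)) else 0)"

text \<open>Multiplication by \<open>y\<close> kills the \<delta> terms, selects row
  \<open>l\<close> of \<open>J1\<close> and \<open>J2\<close>, and turns \<open>z l\<close> into
  \<open>t ^ h\<close>.\<close>

lemma dual_cyc:
  assumes y: "y \<in> m" "y * t = 0" "\<And>k. k \<in> {1..p} \<Longrightarrow> y * z k = (if k = l then t ^ h else 0)"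
    and l: "l \<in> {1..p}"
  shows "y *\<^sub>K cyc \<alpha> \<beta> \<gamma> \<delta> \<eta> \<theta> = (\<Sum>j=1..p. (quad \<eta> \<theta> l j * t ^ h) *\<^sub>K Z j)"
proof -
  \<comment> \<open>With \<open>?f\<close> both sums merge into one over the full square:
    \<open>J1\<close> and \<open>J2\<close> partition the upper triangle, and \<open>quad\<close>
    vanishes below the diagonal.\<close>
  let ?f = "\<lambda>(i, j). if i = l then (quad \<eta> \<theta> i j * t ^ h) *\<^sub>K Z j else 0"
  have "y * t ^ (h - 1) = y * t * t ^ (h - 2)"
    using h_ge by (simp add: mult.assoc numeral_2_eq_2 Suc_diff_Suc flip: power_Suc)
  then have "y *\<^sub>K cyc \<alpha> \<beta> \<gamma> \<delta> \<eta> \<theta> =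
     (\<Sum>i=1..p. (\<delta> i * (y * t)) *\<^sub>K Z i)
     + (\<Sum>(i, j)\<in>J1. (- (\<eta> i j * unit_inv (a i j)) * (y * z i)) *\<^sub>K Z j)
     + (\<Sum>(i, j)\<in>J2. (\<theta> i j * (y * z i)) *\<^sub>K Z j)"
    using socle_w y by (intro kscale_cyc) (simp_all add: mult.commute[of y])
  moreover have "(\<Sum>i=1..p. (\<delta> i * (y * t)) *\<^sub>K Z i) = 0" by (simp add: y(2))
  moreover have "(\<Sum>(i, j)\<in>J1. (- (\<eta> i j * unit_inv (a i j)) * (y * z i)) *\<^sub>K Z j) = (\<Sum>ij\<in>J1. ?f ij)"
    by (intro sum.cong) (auto simp: J1_def y(3) quad_def)
  moreover have "(\<Sum>(i, j)\<in>J2. (\<theta> i j * (y * z i)) *\<^sub>K Z j) = (\<Sum>ij\<in>J2. ?f ij)"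
    by (intro sum.cong) (auto simp: J2_def y(3) quad_def)
  ultimately have "y *\<^sub>K cyc \<alpha> \<beta> \<gamma> \<delta> \<eta> \<theta> = (\<Sum>ij\<in>J1. ?f ij) + (\<Sum>ij\<in>J2. ?f ij)"
    by (simp only: add_0_left)
  also have "\<dots> = (\<Sum>ij\<in>J1 \<union> J2. ?f ij)"
  proof (rule sum.union_disjoint[symmetric])
    show "finite J1" "finite J2"
      by (auto simp: J1_def J2_def intro: finite_subset[of _ "{1..p} \<times> {1..p}"])
  qed (auto simp: J1_def J2_def)
  also have "\<dots> = (\<Sum>ij\<in>{1..p} \<times> {1..p}. ?f ij)"
    by (rule sum.mono_neutral_left) (auto simp: J1_def J2_def quad_def)
  also have "\<dots> = (\<Sum>i=1..p. \<Sum>j=1..p. ?f (i, j))"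
    by (subst sum.cartesian_product) simp
  also have "\<dots> = (\<Sum>i=1..p. if i = l then \<Sum>j=1..p. (quad \<eta> \<theta> l j * t ^ h) *\<^sub>K Z j else 0)"
    by (intro sum.cong) auto
  finally show ?thesis using l by simp
qed

lemma sum_Z_eval:
  "(\<Sum>j=1..p. e j *\<^sub>K Z j) {k} = (if k \<in> {q+1..q+p} then e (k - q) else 0)"
proof -
  have "(\<Sum>j=1..p. e j *\<^sub>K Z j) {k} = (\<Sum>j=1..p. if j = k - q \<and> k > q then e (k - q) else 0)"
    unfolding kos_sum_apply by (intro sum.cong) (auto simp: kgen_def)
  then show ?thesis by auto
qed

section \<open>Application to Sally's system\<close>

lemma cycle_eq_multiple:
  assumes unit: "(\<exists>i\<in>{1..p}. \<delta> i dvd 1) \<or> (\<exists>(i, j)\<in>J1. \<eta> i j dvd 1) \<or> (\<exists>(i, j)\<in>J2. \<theta> i j dvd 1)"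
    and u: "u \<in> cycles (q + p + 1) x (kos_ideal (q + p + 1) (ideal_pow m 2))"
  shows "\<exists>A \<in> cycles (q + p + 1) x (kos_ideal (q + p + 1) m).
    \<exists>A' \<in> boundaries (q + p + 1) x (kos_ideal (q + p + 1) m). u = A \<cdot>\<^sub>K cyc \<alpha> \<beta> \<gamma> \<delta> \<eta> \<theta> + A'"
proof -
  obtain y where y_m: "\<And>i. i \<in> {1..p} \<Longrightarrow> y i \<in> m" and y_t: "\<And>i. i \<in> {1..p} \<Longrightarrow> y i * t = 0"
    and y_z: "\<And>i k. i \<in> {1..p} \<Longrightarrow> k \<in> {1..p} \<Longrightarrow> y i * z k = (if k = i then t ^ h else 0)"
    by (rule dual_z) blast
  let ?n = "q + p + 1" and ?D = "{q+1..q+p}" and ?F = "cyc \<alpha> \<beta> \<gamma> \<delta> \<eta> \<theta>"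
  have D: "k - q \<in> {1..p}" "q + (k - q) = k" if "k \<in> ?D" for k using that by auto
  have pow: "h - 1 > 0" using h_ge by simp
  \<comment> \<open>The \<open>Z\<close> variables occupy the positions \<open>q + 1\<close> to
    \<open>q + p\<close>, while \<open>y\<close>, \<delta> and \<open>quad\<close> are indexed from
    1; hence the shifts by \<open>q\<close>.\<close>
  interpret dual_koszul m ?n x ?D t "t ^ h" "t ^ (h - 1)" "\<lambda>i. y (i - q)" ?F
    "\<lambda>i. \<delta> (i - q)" "\<lambda>l j. quad \<eta> \<theta> (l - q) (j - q)"
  proof
    show "ideal m" by (rule ideal_m)
    show "t \<in> m" by (rule t_m)
    show "t ^ (h - 1) \<in> m"
      using ideal_scale[OF ideal_m t_m, of "t ^ (h - 2)"] h_ge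
      by (simp add: numeral_2_eq_2 Suc_diff_Suc flip: power_Suc2)
    show "t ^ (h - 1) * t = t ^ h" using h_ge by (simp flip: power_Suc2)
    show "x ?n = t" by (rule x_T)
    have pow_x: "t ^ i * x k = 0" if "i > 0" "k \<in> {1..<?n}" for i k
    proof -
      have "k \<in> {1..?n}" using that by simp
      then show ?thesis
        by (cases rule: index_cases) (use that in \<open>auto simp: x_W x_Z t_pow_W t_pow_Z\<close>)
    qed
    show "t ^ (h - 1) * x k = 0" if "k \<in> {1..<?n}" for k using pow_x[OF pow that] .
    show "t * x k = 0" if "k \<in> {1..<?n}" for k using pow_x[of 1 k] that by simp
    show "y (i - q) \<in> m" if "i \<in> ?D" for i using that by (intro y_m) auto
    show "y (i - q) * x k = (if k = i then t ^ h else 0)" if i: "i \<in> ?D" and "k \<in> {1..?n}" for i k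
      using that(2)
    proof (cases rule: index_cases)
      case W
      have "w k * y (i - q) = 0" using W D[OF i] y_m by (intro socle_w)
      then show ?thesis using W i by (simp add: x_W mult.commute)
    next
      case (Z j)
      then show ?thesis using y_z[OF D(1)[OF i] Z(1)] i by (auto simp: x_Z)
    next
      case T
      then show ?thesis using y_t[OF D(1)[OF i]] i unfolding T x_T by simp
    qed
    show "?F \<in> kos_deg ?n 1" using cyc_cycle by (simp add: cycles_def)
    show "t ^ (h - 1) * ?F {k} = (if k \<in> ?D then \<delta> (k - q) * t ^ h else 0)" for k
      using fun_cong[OF t_pow_cyc[of \<alpha> \<beta> \<gamma> \<delta> \<eta> \<theta>], of "{k}"] by (simp only: sum_Z_eval kscale_apply)
    show "y (l - q) * ?F {k} = (if k \<in> ?D then quad \<eta> \<theta> (l - q) (k - q) * t ^ h else 0)"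
      if "l \<in> ?D" for l k
    proof -
      note l = D(1)[OF that]
      have "y (l - q) *\<^sub>K ?F = (\<Sum>j=1..p. (quad \<eta> \<theta> (l - q) j * t ^ h) *\<^sub>K Z j)"
        by (rule dual_cyc[OF y_m[OF l] y_t[OF l] y_z[OF l] l])
      from fun_cong[OF this, of "{k}"] show ?thesis by (simp only: sum_Z_eval kscale_apply)
    qed
    show "quad \<eta> \<theta> (l - q) (k - q) = 0" if "l \<in> ?D" "k \<in> ?D" "k < l" for k l
      using that by (auto simp: quad_def)
  qed auto
  have "u \<in> repr"
  proof (rule cycle_in_repr)
    \<comment> \<open>On \<open>J1\<close> the entry is, up to sign, \<eta> times a unit; on
      \<open>J2\<close> it is \<theta> itself.\<close>
    have quad_unit: "quad \<eta> \<theta> i j dvd 1"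
      if "(i, j) \<in> J1 \<and> \<eta> i j dvd 1 \<or> (i, j) \<in> J2 \<and> \<theta> i j dvd 1" for i j
    proof (cases "(i, j) \<in> J1")
      case True
      then have ij: "i \<in> {1..p}" "j \<in> {1..p}" "i \<le> j" "a i j \<noteq> 0" by (auto simp: J1_def)
      then have "a i j * unit_inv (a i j) = 1" by (intro mult_unit_inv a_cases)
      then have "unit_inv (a i j) dvd 1" by (metis dvd_triv_right)
      moreover have "\<eta> i j dvd 1" using that ij by (auto simp: J2_def)
      ultimately have "\<eta> i j * unit_inv (a i j) dvd 1 * 1" by (intro mult_dvd_mono)
      then show ?thesis using ij by (simp add: quad_def)
    next
      case False
      then show ?thesis using that by (auto simp: J2_def quad_def)
    qed
    from unit show "(\<exists>i\<in>?D. \<delta> (i - q) dvd 1)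
      \<or> (\<exists>l\<in>?D. \<exists>j\<in>?D. l \<le> j \<and> quad \<eta> \<theta> (l - q) (j - q) dvd 1)"
    proof (elim disjE)
      assume "\<exists>i\<in>{1..p}. \<delta> i dvd 1"
      then obtain i where "i \<in> {1..p}" "\<delta> i dvd 1" by blast
      then have "q + i \<in> ?D" "\<delta> (q + i - q) dvd 1" by auto
      then show ?thesis by blast
    next
      assume "\<exists>(i, j)\<in>J1. \<eta> i j dvd 1"
      then obtain i j where ij: "(i, j) \<in> J1" "\<eta> i j dvd 1" by blast
      then have "q + i \<in> ?D" "q + j \<in> ?D" "q + i \<le> q + j" by (auto simp: J1_def)
      moreover have "quad \<eta> \<theta> (q + i - q) (q + j - q) dvd 1" using quad_unit ij by simp
      ultimately show ?thesis by blast
    next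
      assume "\<exists>(i, j)\<in>J2. \<theta> i j dvd 1"
      then obtain i j where ij: "(i, j) \<in> J2" "\<theta> i j dvd 1" by blast
      then have "q + i \<in> ?D" "q + j \<in> ?D" "q + i \<le> q + j" by (auto simp: J2_def)
      moreover have "quad \<eta> \<theta> (q + i - q) (q + j - q) dvd 1" using quad_unit ij by simp
      ultimately show ?thesis by blast
    qed
    show "\<exists>e'. e * t * t = e' * t ^ h" if "e * t * t * t = 0" for e
      using annihilator_t[of e] that by (simp add: numeral_eq_Suc mult.assoc)
    have "ideal (ideal_pow m 2)"
      unfolding numeral_2_eq_2 ideal_pow.simps ideal_prod_def
      by (rule module.subspace_span[OF module_ring])
    then have "u \<in> kos ?n \<and> (\<forall>S. u S \<in> ideal_pow m 2)" "kdiff ?n x u = 0"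
      using u by (auto simp: cycles_def kos_ideal_iff)
    then show "u \<in> kos ?n" "kdiff ?n x u = 0" "\<exists>e. u S = e * t * t" for S
      using pow_m[of 2] by (auto simp: power2_eq_square mult.assoc)
  qed
  then show ?thesis unfolding repr_def by blast
qed

end

theorem lemma5p3:
  fixes m :: "'a::comm_ring_1 set"
    and t :: 'a and z w :: "nat \<Rightarrow> 'a" and a :: "nat \<Rightarrow> nat \<Rightarrow> 'a"
    and \<alpha> \<beta> \<eta> \<theta> :: "nat \<Rightarrow> nat \<Rightarrow> 'a" and \<gamma> \<delta> :: "nat \<Rightarrow> 'a"
    and v r h p q n :: nat
    and x :: "nat \<Rightarrow> 'a" and W Z :: "nat \<Rightarrow> 'a kos" and T F :: "'a kos"
    and J1 J2 :: "(nat \<times> nat) set"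
  assumes "artinian_local m"
    and "stretched m"
    and not_field: "\<not> (\<forall>y::'a. y \<noteq> 0 \<longrightarrow> y dvd 1)"
    and "v = embdim m" and "r = socle_rank m" and "h = stretch_index m"
    and "p = v - r" and "q = r - 1"
    and "h \<ge> 3" and "r \<noteq> v"
    and "sally_system m q p w z t a"
    and "n = q + p + 1" and "x = kos_seq q p w z t"
    and "W = (\<lambda>i. kgen i)" and "Z = (\<lambda>i. kgen (q + i))" and "T = kgen (q + p + 1)"
    and "J1 = {(i, j). 1 \<le> i \<and> i \<le> j \<and> j \<le> p \<and> a i j \<noteq> 0}"
    and "J2 = {(i, j). 1 \<le> i \<and> i \<le> j \<and> j \<le> p \<and> a i j = 0}"
    and "F = (\<Sum>(i, j)\<in>{(i, j). 1 \<le> i \<and> i < j \<and> j \<le> q}. (\<alpha> i j * w i) *\<^sub>K W j)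
           + (\<Sum>j=1..q. \<Sum>i=1..p. (\<beta> i j * w j) *\<^sub>K Z i)
           + (\<Sum>i=1..q. (\<gamma> i * w i) *\<^sub>K T)
           + (\<Sum>i=1..p. (\<delta> i * t) *\<^sub>K Z i)
           + (\<Sum>(i, j)\<in>J1. \<eta> i j *\<^sub>K (t ^ (h - 1) *\<^sub>K T - (unit_inv (a i j) * z i) *\<^sub>K Z j))
           + (\<Sum>(i, j)\<in>J2. (\<theta> i j * z i) *\<^sub>K Z j)"
    and "(\<exists>i\<in>{1..p}. \<delta> i dvd 1) \<or> (\<exists>(i, j)\<in>J1. \<eta> i j dvd 1) \<or> (\<exists>(i, j)\<in>J2. \<theta> i j dvd 1)"
  shows "(\<forall>u \<in> cycles n x (kos_ideal n (ideal_pow m 2)).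
            \<exists>A \<in> cycles n x (kos_ideal n m). \<exists>A' \<in> boundaries n x (kos_ideal n m).
              u = A \<cdot>\<^sub>K F + A')
         \<and> cond_P21 m n x F"
proof -
  interpret sally m q p w z t a h
    using assms(1,2,6,9,11) by unfold_locales (auto simp: artinian_local_def)
  have F: "F = cyc \<alpha> \<beta> \<gamma> \<delta> \<eta> \<theta>"
    unfolding assms(14-19) cyc_def J1_def J2_def ..
  \<comment> \<open>The qualified names denote the constants of the locale, since \<open>J1\<close>
    and \<open>J2\<close> are variables of the theorem.\<close>
  have unit: "(\<exists>i\<in>{1..p}. \<delta> i dvd 1) \<or> (\<exists>(i, j)\<in>sally.J1 p a. \<eta> i j dvd 1)
      \<or> (\<exists>(i, j)\<in>sally.J2 p a. \<theta> i j dvd 1)"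
    using assms(20) unfolding assms(17,18) J1_def J2_def .
  have mult: "\<exists>A \<in> cycles n x (kos_ideal n m). \<exists>A' \<in> boundaries n x (kos_ideal n m).
      u = A \<cdot>\<^sub>K F + A'" if "u \<in> cycles n x (kos_ideal n (ideal_pow m 2))" for u
    using cycle_eq_multiple[OF unit] that unfolding F assms(12,13) by blast
  moreover have "F \<in> cycles n x (kos_deg n 1)"
    using cyc_cycle unfolding F assms(12,13) .
  moreover have "\<exists>u' \<in> cycles n x (kos_ideal n m). u - u' \<cdot>\<^sub>K F \<in> boundaries n x (kos_ideal n m)"
    if "u \<in> cycles n x (kos_ideal n (ideal_pow m 2))" for u
    using mult[OF that] by (metis add_diff_cancel_left')
  ultimately show ?thesis unfolding cond_P21_def by blast
qed

end
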